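(* There exists an optimal prefix-free machine $V$ which satisfies $\#S_V(n,s)=2^{n-H(n,s)+O(1)}$. Namely, there exist an optimal prefix-free machine $V$ and $d\in\mathbb{N}$ such that (i) $\#S_V(n,s)\le 2^{n-H(n,s)+d}$ for all $n\in\mathbb{N}$ and all $s\in\{0,1\}^*$, and (ii) $2^{n-H(n,s)-d}\le \#S_V(n,s)$ for all $n\in\mathbb{N}$ and all $s\in\{0,1\}^*$ with $n-H(n,s)\ge d$.
   Context: $\{0,1\}^*$ is the set of finite binary strings (including the empty string $\lambda$), and $|p|$ is the length of a string $p$. $\mathbb{N}=\{0,1,2,\dots\}$. $\{0,1\}^*$ is ordered as $\lambda,0,1,00,01,10,11,000,\dots$ and identified with $\mathbb{N}$ in this order (that is, $s$ is identified with the natural number $1s-1$, where the concatenation $1s$ is read as a binary integer). $\#S$ is the cardinality of a set $S$, and $\operatorname{dom} f$ is the domain of definition of a (partial) function $f$. A subset of $\{0,1\}^*$ is prefix-free if no string in it is a prefix of another string in it. A prefix-free machine is a partial recursive function $C\colon\{0,1\}^*\to\{0,1\}^*$ such that $\operatorname{dom} C$ is a prefix-free set. For a prefix-free machine $C$ and $s\in\{0,1\}^*$, $H_C(s)=\min\{\,|p| \mid p\in\{0,1\}^*,\ C(p)=s\,\}$, with $H_C(s)=\infty$ if no such $p$ exists. A prefix-free machine $V$ is optimal if for each prefix-free machine $C$ there exists $d\in\mathbb{N}$ such that $H_V(s)\le H_C(s)+d$ for every $s\in\{0,1\}^*$. Throughout, a particular optimal prefix-free machine $U$ is fixed (not depending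 on $V$) and $H(s)=H_U(s)$. A particular bijective total recursive function $b\colon\{0,1\}^*\times\{0,1\}^*\to\{0,1\}^*$ is fixed, and $H(s,t)=H(b(s,t))$; in $H(n,s)$ with $n\in\mathbb{N}$, $n$ is regarded as a string via the identification above. For a prefix-free machine $C$, $n\in\mathbb{N}$ and $s\in\{0,1\}^*$, $S_C(n,s)=\{\,p\in\{0,1\}^*\mid |p|\le n \text{ and } C(p)=s\,\}$. *)

theory Defs
  imports Complex_Main "HOL-Library.Sublist" "HOL-Library.Extended_Nat"
begin

text \<open>
  \<open>partrec k f\<close>: the restriction of \<open>f\<close> to argument lists of length \<open>k\<close> is a \<open>k\<close>-ary partial
  recursive function in the sense of Kleene.  The values of \<open>f\<close> on lists of any other length are
  irrelevant, which is the purpose of the rule \<open>cong\<close>.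
\<close>

inductive partrec :: "nat \<Rightarrow> (nat list \<Rightarrow> nat option) \<Rightarrow> bool" where
  zero: "partrec k (\<lambda>xs. Some 0)"
| succ: "partrec 1 (\<lambda>xs. Some (Suc (xs ! 0)))"
| proj: "i < k \<Longrightarrow> partrec k (\<lambda>xs. Some (xs ! i))"
| comp: "partrec (length gs) f \<Longrightarrow> (\<And>g. g \<in> set gs \<Longrightarrow> partrec k g) \<Longrightarrow>
    partrec k (\<lambda>xs. Option.bind (those (map (\<lambda>g. g xs) gs)) f)"
| prec: "partrec k f \<Longrightarrow> partrec (Suc (Suc k)) g \<Longrightarrow>
    partrec (Suc k) (\<lambda>xs. rec_nat (f (tl xs))
      (\<lambda>m r. Option.bind r (\<lambda>y. g (m # y # tl xs))) (hd xs))"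
| minim: "partrec (Suc k) f \<Longrightarrow>
    partrec k (\<lambda>xs.
      if \<exists>n. f (n # xs) = Some 0 \<and> (\<forall>m<n. f (m # xs) \<noteq> None)
      then Some (LEAST n. f (n # xs) = Some 0) else None)"
| cong: "partrec k f \<Longrightarrow> (\<And>xs. length xs = k \<Longrightarrow> g xs = f xs) \<Longrightarrow> partrec k g"

type_synonym str = "bool list"

text \<open>The identification of strings with natural numbers in length-lexicographic order:
  \<open>s\<close> corresponds to \<open>1s - 1\<close>, where \<open>1s\<close> is read in binary, most significant digit first.\<close>

definition nat_of_str :: "str \<Rightarrow> nat" where
  "nat_of_str s = foldl (\<lambda>m c. 2 * m + of_bool c) 1 s - 1"

definition str_of_nat :: "nat \<Rightarrow> str" where
  "str_of_nat = inv nat_of_str"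

lemma foldl_binary_pos: "foldl (\<lambda>m c. 2 * m + of_bool c) (1::nat) s \<ge> 1"
  by (induction s rule: rev_induct) auto

lemma nat_of_str_Nil [simp]: "nat_of_str [] = 0"
  by (simp add: nat_of_str_def)

lemma nat_of_str_snoc: "nat_of_str (s @ [c]) = 2 * nat_of_str s + (if c then 2 else 1)"
  using foldl_binary_pos[of s] by (simp add: nat_of_str_def) arith

lemma bij_nat_of_str: "bij nat_of_str"
proof (rule bijI)
  show "inj nat_of_str"
  proof (rule injI)
    fix s t :: str
    show "nat_of_str s = nat_of_str t \<Longrightarrow> s = t"
    proof (induction s arbitrary: t rule: rev_induct)
      case Nil
      then show ?case
        by (cases t rule: rev_cases) (auto simp: nat_of_str_snoc split: if_splits)
    next
      case (snoc c s)
      then obtain u e where t: "t = u @ [e]"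
        by (cases t rule: rev_cases) (auto simp: nat_of_str_snoc split: if_splits)
      have eq: "2 * nat_of_str s + (if c then 2 else 1) = 2 * nat_of_str u + (if e then 2 else 1)"
        using snoc.prems by (simp add: t nat_of_str_snoc)
      then have "c = e" and "nat_of_str s = nat_of_str u"
        by (auto split: if_splits; presburger)+
      then show ?case using snoc.IH t by simp
    qed
  qed
  have "\<exists>s. nat_of_str s = n" for n
  proof (induction n rule: less_induct)
    case (less n)
    show ?case
    proof (cases "n = 0")
      case True
      then show ?thesis using nat_of_str_Nil by blast
    next
      case False
      then obtain s where s: "nat_of_str s = (n - 1) div 2"
        using less[of "(n - 1) div 2"] by force
      have "nat_of_str (s @ [even n]) = n"
        using False by (auto simp: nat_of_str_snoc s)
      then show ?thesis by blast
    qed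
  qed
  then show "surj nat_of_str" by (metis surjI)
qed

definition partial_recursive :: "(str \<Rightarrow> str option) \<Rightarrow> bool" where
  "partial_recursive C \<longleftrightarrow>
    (\<exists>f. partrec 1 f \<and> (\<forall>p. f [nat_of_str p] = map_option nat_of_str (C p)))"

definition total_recursive2 :: "(str \<times> str \<Rightarrow> str) \<Rightarrow> bool" where
  "total_recursive2 b \<longleftrightarrow>
    (\<exists>f. partrec 2 f \<and>
      (\<forall>s t. f [nat_of_str s, nat_of_str t] = Some (nat_of_str (b (s, t)))))"

definition prefix_free :: "str set \<Rightarrow> bool" where
  "prefix_free A \<longleftrightarrow> (\<forall>p\<in>A. \<forall>q\<in>A. \<not> strict_prefix p q)"

definition prefix_free_machine :: "(str \<Rightarrow> str option) \<Rightarrow> bool" where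
  "prefix_free_machine C \<longleftrightarrow> partial_recursive C \<and> prefix_free (dom C)"

text \<open>In \<^typ>\<open>enat\<close> the infimum of a nonempty set is attained, and \<open>Inf {} = \<infinity>\<close>.\<close>

definition complexity :: "(str \<Rightarrow> str option) \<Rightarrow> str \<Rightarrow> enat" where
  "complexity C s = Inf {enat (length p) | p. C p = Some s}"

definition optimal :: "(str \<Rightarrow> str option) \<Rightarrow> bool" where
  "optimal V \<longleftrightarrow> prefix_free_machine V \<and>
    (\<forall>C. prefix_free_machine C \<longrightarrow>
      (\<exists>d::nat. \<forall>s. complexity V s \<le> complexity C s + enat d))"

definition programs :: "(str \<Rightarrow> str option) \<Rightarrow> nat \<Rightarrow> str \<Rightarrow> str set" where
  "programs C n s = {p. length p \<le> n \<and> C p = Some s}"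

text \<open>\<open>H(n, s)\<close> relative to \<open>U\<close> and \<open>b\<close>, as a natural number.  The value is only
  meaningful if \<open>complexity U\<close> is finite everywhere; \<open>optimal_complexity_finite\<close> below
  shows that this holds for optimal \<open>U\<close>.\<close>

definition pair_complexity ::
    "(str \<Rightarrow> str option) \<Rightarrow> (str \<times> str \<Rightarrow> str) \<Rightarrow> nat \<Rightarrow> str \<Rightarrow> nat" where
  "pair_complexity U b n s = the_enat (complexity U (b (str_of_nat n, s)))"

lemma partrec_zero_only: "\<exists>f. partrec 1 f \<and> (\<forall>n. f [n] = (if n = 0 then Some c else None))"
proof (induction c)
  case 0
  let ?g = "\<lambda>xs::nat list. Some (xs ! 1)"
  have "partrec (Suc 1) ?g" by (rule partrec.proj) simp
  from partrec.minim[OF this] show ?case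
    by (intro exI conjI) (assumption, auto)
next
  case (Suc c)
  then obtain f where f: "partrec 1 f" "\<And>n. f [n] = (if n = 0 then Some c else None)"
    by blast
  have "partrec (length [f]) (\<lambda>xs. Some (Suc (xs ! 0)))"
    using partrec.succ by simp
  from partrec.comp[OF this, of 1] have
    "partrec 1 (\<lambda>xs. Option.bind (those (map (\<lambda>g. g xs) [f])) (\<lambda>xs. Some (Suc (xs ! 0))))"
    using f(1) by simp
  then show ?case
    by (intro exI conjI) (assumption, simp add: f(2))
qed

lemma optimal_complexity_finite:
  assumes "optimal U"
  shows "complexity U s \<noteq> \<infinity>"
proof -
  define C :: "str \<Rightarrow> str option" where "C = [[] \<mapsto> s]"
  obtain f where "partrec 1 f"
    and f: "\<And>n. f [n] = (if n = 0 then Some (nat_of_str s) else None)"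
    using partrec_zero_only by blast
  moreover have "nat_of_str p = 0 \<longleftrightarrow> p = []" for p
    by (metis bij_nat_of_str bij_is_inj injD nat_of_str_Nil)
  then have "\<forall>p. f [nat_of_str p] = map_option nat_of_str (C p)"
    by (simp add: f C_def)
  ultimately have "prefix_free_machine C"
    by (auto simp: prefix_free_machine_def partial_recursive_def prefix_free_def C_def)
  then obtain d where d: "complexity U s \<le> complexity C s + enat d"
    using assms unfolding optimal_def by blast
  have "complexity C s \<le> enat (length ([]::str))"
    unfolding complexity_def by (rule Inf_lower) (auto simp: C_def)
  then have "complexity C s \<le> 0" by (simp add: zero_enat_def)
  then have "complexity C s = 0" by simp
  with d show ?thesis by (cases "complexity U s") auto
qed

end

theory Submission
  imports Defs
begin

text \<open>
  Thin out \<open>U\<close> so that it keeps, for each length and each output, only the first program found by a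
  dovetailed enumeration.  Shortest programs survive (possibly replaced by others of the same
  length).  Let \<open>V x = s\<close> iff some prefix \<open>p\<close> of \<open>x\<close> is a surviving
  program for \<open>b (length x, s)\<close>; a program \<open>p\<close> for \<open>(n, s)\<close> thus contributes \<open>2 ^ (n - length p)\<close>
  programs of length exactly \<open>n\<close>, which gives the lower bound.  As a surviving program is determined
  by its length and output, the programs of length \<open>m\<close> for \<open>s\<close> number at most
  \<open>2 * 2 ^ (m - H(m, s))\<close>.  Prefixing a program for \<open>(m, s)\<close> by \<open>1 ^ j 0\<close> yields one for
  \<open>(m + 2 * j, s)\<close> or \<open>(m + 2 * j + 1, s)\<close>, so \<open>H(n, s) \<le> H(m, s) + (n - m) div 2 + O(1)\<close>, and the
  sum over \<open>m \<le> n\<close> is dominated by a geometric series.  The same tags show that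
  \<open>H(h + 2 * c, s) \<le> h + 2 * c\<close> for \<open>h = H(s)\<close> and a suitable constant \<open>c\<close>, so \<open>V\<close> is optimal.
\<close>

section \<open>Total recursive functions\<close>

text \<open>Stating totality on plain numbers hides \<open>those\<close> and
  \<open>Option.bind\<close>, so that closure properties can be applied syntactically to ordinary
  terms.\<close>

definition tot :: "nat \<Rightarrow> (nat list \<Rightarrow> nat) \<Rightarrow> bool" where
  "tot k F \<longleftrightarrow> partrec k (\<lambda>xs. Some (F xs))"

abbreviation dec :: "nat \<Rightarrow> (nat list \<Rightarrow> bool) \<Rightarrow> bool" where
  "dec k P \<equiv> tot k (\<lambda>xs. of_bool (P xs))"

lemma those_map_Some [simp]: "those (map (\<lambda>g. Some (h g)) gs) = Some (map h gs)"
  by (induction gs) auto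

lemma tot_cong: "tot k F \<Longrightarrow> (\<And>xs. length xs = k \<Longrightarrow> G xs = F xs) \<Longrightarrow> tot k G"
  unfolding tot_def by (rule partrec.cong) auto

lemma partrec_comp_tot:
  assumes "partrec (length gs) f" "\<And>g. g \<in> set gs \<Longrightarrow> tot k g"
  shows "partrec k (\<lambda>xs. f (map (\<lambda>g. g xs) gs))"
proof -
  have "partrec k (\<lambda>xs. Option.bind (those (map (\<lambda>g. g xs) (map (\<lambda>g xs. Some (g xs)) gs))) f)"
    using assms by (intro partrec.comp) (auto simp: tot_def)
  then show ?thesis by (simp add: comp_def)
qed

lemma tot_comp:
  assumes "tot (length gs) F" "\<And>g. g \<in> set gs \<Longrightarrow> tot k g"
  shows "tot k (\<lambda>xs. F (map (\<lambda>g. g xs) gs))"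
  using partrec_comp_tot[of gs "\<lambda>xs. Some (F xs)" k] assms by (simp add: tot_def)

lemma tot_nth: "i < k \<Longrightarrow> tot k (\<lambda>xs. xs ! i)"
  unfolding tot_def by (rule partrec.proj)

lemma map_nth_drop: "length xs = d + k \<Longrightarrow> map (\<lambda>i. xs ! (d + i)) [0..<k] = drop d xs"
  by (rule nth_equalityI) auto

text \<open>Kleene composition must list a function for every argument. Here projections fill in the
  unchanged tail, so that only the new leading arguments \<open>hs\<close> need to be given.
  Recursion and search use this to rearrange their bookkeeping arguments.\<close>

lemma tot_append_drop:
  assumes "tot (length hs + k) F" "list_all (tot (d + k)) hs"
  shows "tot (d + k) (\<lambda>xs. F (map (\<lambda>h. h xs) hs @ drop d xs))"
proof -
  let ?gs = "hs @ map (\<lambda>i xs. xs ! (d + i)) [0..<k]"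
  have "tot (d + k) (\<lambda>xs. F (map (\<lambda>g. g xs) ?gs))"
    using assms by (intro tot_comp) (auto intro: tot_nth simp: list_all_iff)
  then show ?thesis
    by (rule tot_cong) (simp add: comp_def map_nth_drop)
qed

lemma tot_drop: "tot k F \<Longrightarrow> tot (d + k) (\<lambda>xs. F (drop d xs))"
  using tot_append_drop[of "[]"] by simp

lemma tot_tl: "tot k F \<Longrightarrow> tot (Suc k) (\<lambda>xs. F (tl xs))"
  using tot_drop[of k F 1] by (simp add: drop_Suc)

text \<open>Each bounded quantifier or search puts its variable in front of the argument list, so
  outer variables appear behind iterated \<open>tl\<close>. Six levels suffice for the most deeply
  nested relation below.\<close>

lemma tot_nth_tl:
  "Suc i < k \<Longrightarrow> tot k (\<lambda>xs. tl xs ! i)"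
  "Suc (Suc i) < k \<Longrightarrow> tot k (\<lambda>xs. tl (tl xs) ! i)"
  "Suc (Suc (Suc i)) < k \<Longrightarrow> tot k (\<lambda>xs. tl (tl (tl xs)) ! i)"
  "Suc (Suc (Suc (Suc i))) < k \<Longrightarrow> tot k (\<lambda>xs. tl (tl (tl (tl xs))) ! i)"
  "Suc (Suc (Suc (Suc (Suc i)))) < k \<Longrightarrow> tot k (\<lambda>xs. tl (tl (tl (tl (tl xs)))) ! i)"
  "Suc (Suc (Suc (Suc (Suc (Suc i))))) < k \<Longrightarrow> tot k (\<lambda>xs. tl (tl (tl (tl (tl (tl xs))))) ! i)"
  by (rule tot_cong[OF tot_nth]; simp add: nth_tl)+

lemma tot_app1: "tot 1 (\<lambda>xs. f (xs ! 0)) \<Longrightarrow> tot k g \<Longrightarrow> tot k (\<lambda>xs. f (g xs))"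
  using tot_comp[of "[g]" "\<lambda>xs. f (xs ! 0)" k] by simp

lemma tot_app2:
  "tot 2 (\<lambda>xs. f (xs ! 0) (xs ! 1)) \<Longrightarrow> tot k g \<Longrightarrow> tot k h \<Longrightarrow> tot k (\<lambda>xs. f (g xs) (h xs))"
  using tot_comp[of "[g, h]" "\<lambda>xs. f (xs ! 0) (xs ! 1)" k] by (auto simp: numeral_2_eq_2)

lemma tot_app3:
  "tot 3 (\<lambda>xs. f (xs ! 0) (xs ! 1) (xs ! 2)) \<Longrightarrow> tot k g \<Longrightarrow> tot k h \<Longrightarrow> tot k i \<Longrightarrow>
    tot k (\<lambda>xs. f (g xs) (h xs) (i xs))"
  using tot_comp[of "[g, h, i]" "\<lambda>xs. f (xs ! 0) (xs ! 1) (xs ! 2)" k]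
  by (auto simp: numeral_3_eq_3)

lemma tot_Suc: "tot k f \<Longrightarrow> tot k (\<lambda>xs. Suc (f xs))"
  using tot_app1[of Suc] partrec.succ by (simp add: tot_def)

lemma tot_const: "tot k (\<lambda>xs. c)"
  by (induction c) (auto intro: tot_Suc simp: tot_def[of _ "\<lambda>_. 0"] partrec.zero)

text \<open>The rule \<open>prec\<close> recurses on the head of the list; prepending the value
  \<open>n xs\<close> allows an arbitrary total function as the number of steps.\<close>

lemma tot_rec_nat:
  assumes "tot k n" "tot k a" "tot (Suc (Suc k)) (\<lambda>ys. g (ys ! 0) (ys ! 1) (tl (tl ys)))"
  shows "tot k (\<lambda>xs. rec_nat (a xs) (\<lambda>m r. g m r xs) (n xs))"
proof -
  let ?g = "\<lambda>ys. g (ys ! 0) (ys ! 1) (tl (tl ys))"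
  have "partrec (Suc k) (\<lambda>xs. rec_nat (Some (a (tl xs)))
      (\<lambda>m r. Option.bind r (\<lambda>y. Some (?g (m # y # tl xs)))) (hd xs))"
    using partrec.prec assms(2,3) unfolding tot_def .
  moreover have "rec_nat (Some (a ys)) (\<lambda>m r. Option.bind r (\<lambda>y. Some (?g (m # y # ys)))) i
      = Some (rec_nat (a ys) (\<lambda>m r. g m r ys) i)" for i ys
    by (induction i) auto
  ultimately have "tot (Suc k) (\<lambda>xs. rec_nat (a (tl xs)) (\<lambda>m r. g m r (tl xs)) (hd xs))"
    by (simp add: tot_def)
  then show ?thesis
    using tot_append_drop[of "[n]" k "\<lambda>xs. rec_nat (a (tl xs)) (\<lambda>m r. g m r (tl xs)) (hd xs)" 0]
      assms(1) by simp
qed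

section \<open>Primitive recursive arithmetic\<close>

lemma tot_add:
  assumes "tot k f" "tot k g" shows "tot k (\<lambda>xs. f xs + g xs)"
proof -
  have *: "rec_nat x (\<lambda>_ r. Suc r) y = x + y" for x y by (induction y) auto
  have "tot k (\<lambda>xs. rec_nat (f xs) (\<lambda>_ r. Suc r) (g xs))"
    by (intro tot_rec_nat tot_Suc tot_nth assms) simp
  then show ?thesis by (simp add: *)
qed

lemma tot_mult:
  assumes "tot k f" "tot k g" shows "tot k (\<lambda>xs. f xs * g xs)"
proof -
  have *: "x * y = rec_nat 0 (\<lambda>_ r. r + x) y" for x y :: nat by (induction y) auto
  have "tot 2 (\<lambda>xs. xs ! 0 * xs ! 1)"
    unfolding * by (intro tot_rec_nat tot_nth tot_add tot_nth_tl tot_const) auto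
  then show ?thesis using assms by (rule tot_app2)
qed

lemma tot_diff:
  assumes "tot k f" "tot k g" shows "tot k (\<lambda>xs. f xs - g xs)"
proof -
  have *: "x - Suc 0 = rec_nat 0 (\<lambda>m _. m) x" for x by (cases x) auto
  have "tot 1 (\<lambda>xs. xs ! 0 - Suc 0)"
    unfolding * by (intro tot_rec_nat tot_nth tot_const) auto
  note pred = tot_app1[OF this]
  have *: "rec_nat x (\<lambda>_ r. r - Suc 0) y = x - y" for x y by (induction y) auto
  have "tot k (\<lambda>xs. rec_nat (f xs) (\<lambda>_ r. r - Suc 0) (g xs))"
    by (intro tot_rec_nat assms pred tot_nth) auto
  then show ?thesis by (simp add: *)
qed

lemma tot_power2:
  assumes "tot k f" shows "tot k (\<lambda>xs. 2 ^ f xs)"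
proof -
  have *: "2 ^ x = rec_nat (Suc 0) (\<lambda>_ r. r + r) x" for x by (induction x) auto
  have "tot 1 (\<lambda>xs. 2 ^ (xs ! 0))"
    unfolding * by (intro tot_rec_nat tot_nth tot_add tot_const) auto
  then show ?thesis using assms by (rule tot_app1)
qed

section \<open>Decidable predicates and bounded quantifiers\<close>

lemma dec_not: "dec k P \<Longrightarrow> dec k (\<lambda>xs. \<not> P xs)"
  by (rule tot_cong[OF tot_diff[OF tot_const[of k 1], of "\<lambda>xs. of_bool (P xs)"]]) auto

lemma dec_conj: "dec k P \<Longrightarrow> dec k Q \<Longrightarrow> dec k (\<lambda>xs. P xs \<and> Q xs)"
  using tot_mult[of k "\<lambda>xs. of_bool (P xs)" "\<lambda>xs. of_bool (Q xs)"] by (simp add: of_bool_conj)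

lemma dec_imp: "dec k P \<Longrightarrow> dec k Q \<Longrightarrow> dec k (\<lambda>xs. P xs \<longrightarrow> Q xs)"
  using dec_not[OF dec_conj[OF _ dec_not], of k P Q] by simp

text \<open>With truncated subtraction, \<open>1 - (f - g)\<close> is the indicator of
  \<open>f \<le> g\<close>.\<close>

lemma dec_le: "tot k f \<Longrightarrow> tot k g \<Longrightarrow> dec k (\<lambda>xs. f xs \<le> g xs)"
  by (rule tot_cong[OF tot_diff[OF tot_const[of k 1] tot_diff[of k f g]]]) auto

lemma dec_less: "tot k f \<Longrightarrow> tot k g \<Longrightarrow> dec k (\<lambda>xs. f xs < g xs)"
  using dec_not[OF dec_le, of k g f] by (simp add: not_le)

lemma dec_eq: "tot k f \<Longrightarrow> tot k g \<Longrightarrow> dec k (\<lambda>xs. f xs = g xs)"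
  unfolding order.eq_iff by (intro dec_conj dec_le)

lemma tot_if:
  assumes "dec k P" "tot k f" "tot k g" shows "tot k (\<lambda>xs. if P xs then f xs else g xs)"
  by (rule tot_cong[OF tot_add[OF tot_mult[OF assms(1,2)] tot_mult[OF dec_not[OF assms(1)] assms(3)]]])
    auto

lemma dec_ex_less:
  assumes "tot k n" "dec (Suc k) (\<lambda>ys. P (ys ! 0) (tl ys))"
  shows "dec k (\<lambda>xs. \<exists>i<n xs. P i xs)"
proof -
  let ?r = "\<lambda>xs. rec_nat 0 (\<lambda>m r. if P m xs then 1 else r)"
  have *: "?r xs j = of_bool (\<exists>i<j. P i xs)" for j xs
    by (induction j) (auto simp: less_Suc_eq)
  \<comment> \<open>The recursion puts both the counter and the accumulated value before the
    parameters, so two entries are skipped instead of one.\<close>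
  have "dec (Suc (Suc k)) (\<lambda>ys. P (ys ! 0) (tl (tl ys)))"
    using tot_append_drop[of "[\<lambda>ys. ys ! 0]" k "\<lambda>ys. of_bool (P (ys ! 0) (tl ys))" 2] assms(2)
    by (simp add: tot_nth drop_Suc numeral_2_eq_2)
  then have "tot k (\<lambda>xs. ?r xs (n xs))"
    by (intro tot_rec_nat tot_if tot_nth tot_const assms) auto
  then show ?thesis by (simp only: *)
qed

lemma dec_ex_le:
  assumes "tot k n" "dec (Suc k) (\<lambda>ys. P (ys ! 0) (tl ys))"
  shows "dec k (\<lambda>xs. \<exists>i\<le>n xs. P i xs)"
  using dec_ex_less[OF tot_Suc] assms by (simp add: less_Suc_eq_le)

lemma dec_all_less:
  assumes "tot k n" "dec (Suc k) (\<lambda>ys. P (ys ! 0) (tl ys))"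
  shows "dec k (\<lambda>xs. \<forall>i<n xs. P i xs)"
  using dec_not[OF dec_ex_less[of k n "\<lambda>i xs. \<not> P i xs"]] assms dec_not by auto

lemma dec_all_le:
  assumes "tot k n" "dec (Suc k) (\<lambda>ys. P (ys ! 0) (tl ys))"
  shows "dec k (\<lambda>xs. \<forall>i\<le>n xs. P i xs)"
  using dec_all_less[OF tot_Suc] assms by (simp add: less_Suc_eq_le)

lemma dec_ball: "(\<And>g. g \<in> set gs \<Longrightarrow> dec k (P g)) \<Longrightarrow> dec k (\<lambda>xs. \<forall>g\<in>set gs. P g xs)"
proof (induction gs)
  case Nil
  then show ?case using tot_const[of k 1] by simp
next
  case (Cons g gs)
  then show ?case using dec_conj[of k "P g"] by simp
qed

text \<open>The value \<open>0\<close> is reserved for failure, hence the \<open>Suc\<close>. Later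
  hits overwrite earlier ones; the search is applied only to predicates with at most one
  witness.\<close>

definition bounded_search :: "(nat \<Rightarrow> bool) \<Rightarrow> nat \<Rightarrow> nat" where
  "bounded_search Q t = rec_nat 0 (\<lambda>m r. if Q m then Suc m else r) t"

lemma bounded_search_eq_Suc:
  assumes "\<And>m n. Q m \<Longrightarrow> Q n \<Longrightarrow> m = n"
  shows "bounded_search Q t = Suc n \<longleftrightarrow> n < t \<and> Q n"
  using assms by (induction t) (auto simp: bounded_search_def less_Suc_eq)

text \<open>Of two candidates the smaller would have to satisfy both \<open>h m = Suc 0\<close> and
  \<open>Suc 0 < h m\<close>. In the coding of approximations below, \<open>Suc 0\<close> is the
  computed value zero and anything larger is a computed nonzero value, so this is a search for the
  first zero.\<close>

lemma bounded_search_first_eq_Suc: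
  "bounded_search (\<lambda>n. h n = Suc 0 \<and> (\<forall>m<n. Suc 0 < h m)) t = Suc n \<longleftrightarrow>
    n < t \<and> h n = Suc 0 \<and> (\<forall>m<n. Suc 0 < h m)"
  by (rule bounded_search_eq_Suc) (metis linorder_neqE_nat less_irrefl)

lemma tot_bounded_search:
  assumes "tot k n" "dec (Suc k) (\<lambda>ys. P (ys ! 0) (tl ys))"
  shows "tot k (\<lambda>xs. bounded_search (\<lambda>i. P i xs) (n xs))"
proof -
  have "dec (Suc (Suc k)) (\<lambda>ys. P (ys ! 0) (tl (tl ys)))"
    using tot_append_drop[of "[\<lambda>ys. ys ! 0]" k "\<lambda>ys. of_bool (P (ys ! 0) (tl ys))" 2] assms(2)
    by (simp add: tot_nth drop_Suc numeral_2_eq_2)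
  then show ?thesis
    unfolding bounded_search_def
    by (intro tot_rec_nat tot_if tot_nth tot_const tot_Suc assms) auto
qed


section \<open>Partial recursive functions and recursively enumerable graphs\<close>

lemma those_eq_Some: "those ys = Some zs \<longleftrightarrow> ys = map Some zs"
  by (induction ys arbitrary: zs) (auto split: option.splits simp: map_eq_Cons_conv Cons_eq_map_conv)

text \<open>\<open>G\<close> takes the number of computation steps as an additional first argument; the value \<open>0\<close>
  means that no result has been found yet.\<close>

definition approximates :: "nat \<Rightarrow> (nat list \<Rightarrow> nat option) \<Rightarrow> (nat list \<Rightarrow> nat) \<Rightarrow> bool" where
  "approximates k f G \<longleftrightarrow> tot (Suc k) G \<and>
    (\<forall>xs. length xs = k \<longrightarrow>
      (\<forall>t y. G (t # xs) = Suc y \<longrightarrow> f xs = Some y) \<and>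
      (\<forall>y. f xs = Some y \<longrightarrow> (\<forall>\<^sub>F t in sequentially. G (t # xs) = Suc y)))"

lemma approximatesI:
  assumes "tot (Suc k) G"
    and "\<And>xs t y. length xs = k \<Longrightarrow> G (t # xs) = Suc y \<Longrightarrow> f xs = Some y"
    and "\<And>xs y. length xs = k \<Longrightarrow> f xs = Some y \<Longrightarrow> \<forall>\<^sub>F t in sequentially. G (t # xs) = Suc y"
  shows "approximates k f G"
  using assms by (auto simp: approximates_def)

lemma approximatesD:
  assumes "approximates k f G"
  shows "tot (Suc k) G"
    and "length xs = k \<Longrightarrow> G (t # xs) = Suc y \<Longrightarrow> f xs = Some y"
    and "length xs = k \<Longrightarrow> f xs = Some y \<Longrightarrow> \<forall>\<^sub>F t in sequentially. G (t # xs) = Suc y"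
  using assms by (auto simp: approximates_def)

lemma approximates_total:
  "tot k F \<Longrightarrow> approximates k (\<lambda>xs. Some (F xs)) (\<lambda>ys. Suc (F (tl ys)))"
  by (rule approximatesI) (auto intro: tot_Suc tot_tl)

text \<open>All inner computations and the outer one run with the same step bound. There are
  finitely many of them, so from some bound on they have all delivered their values.\<close>

lemma approximates_comp:
  assumes F: "approximates (length gs) f F" and H: "\<And>g. g \<in> set gs \<Longrightarrow> approximates k g (H g)"
  shows "approximates k (\<lambda>xs. Option.bind (those (map (\<lambda>g. g xs) gs)) f)
    (\<lambda>ys. if \<forall>g\<in>set gs. 0 < H g ys then F (ys ! 0 # map (\<lambda>g. H g ys - 1) gs) else 0)"
proof (rule approximatesI)
  let ?hs = "(\<lambda>ys. ys ! 0) # map (\<lambda>g ys. H g ys - 1) gs"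
  have H_tot: "tot (Suc k) (H g)" if "g \<in> set gs" for g
    using approximatesD(1) H that .
  have "tot (Suc k) (\<lambda>ys. F (map (\<lambda>h. h ys) ?hs))"
    using approximatesD(1)[OF F] H_tot
    by (intro tot_comp) (auto intro!: tot_nth tot_diff[where g = "\<lambda>_. Suc 0"] tot_const)
  then show "tot (Suc k) (\<lambda>ys. if \<forall>g\<in>set gs. 0 < H g ys
      then F (ys ! 0 # map (\<lambda>g. H g ys - 1) gs) else 0)"
    by (intro tot_if dec_ball dec_less tot_const H_tot) (simp_all add: comp_def)
next
  fix xs t y
  assume xs: "length xs = k" and eq: "(if \<forall>g\<in>set gs. 0 < H g (t # xs)
    then F ((t # xs) ! 0 # map (\<lambda>g. H g (t # xs) - 1) gs) else 0) = Suc y"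
  have pos: "0 < H g (t # xs)" if "g \<in> set gs" for g
    using eq that by (auto split: if_splits)
  have "g xs = Some (H g (t # xs) - 1)" if "g \<in> set gs" for g
    using approximatesD(2)[OF H[OF that] xs, of t] pos[OF that] by simp
  then have "those (map (\<lambda>g. g xs) gs) = Some (map (\<lambda>g. H g (t # xs) - 1) gs)"
    by (simp add: those_eq_Some)
  moreover have "f (map (\<lambda>g. H g (t # xs) - 1) gs) = Some y"
    using approximatesD(2)[OF F, of _ t] eq pos by simp
  ultimately show "Option.bind (those (map (\<lambda>g. g xs) gs)) f = Some y"
    by simp
next
  fix xs y
  assume xs: "length xs = k" and "Option.bind (those (map (\<lambda>g. g xs) gs)) f = Some y"
  then obtain zs where zs: "map (\<lambda>g. g xs) gs = map Some zs" "f zs = Some y"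
    by (auto simp: bind_eq_Some_conv those_eq_Some)
  have g: "g xs = Some (the (g xs))" if "g \<in> set gs" for g
  proof -
    have "g xs \<in> set (map Some zs)" unfolding zs(1)[symmetric] using that by simp
    then show ?thesis by auto
  qed
  have "zs = map (\<lambda>g. the (g xs)) gs"
    using arg_cong[OF zs(1), of "map the"] by (simp add: comp_def)
  moreover have "length zs = length gs" using zs(1) by (metis length_map)
  ultimately have "\<forall>\<^sub>F t in sequentially. F (t # map (\<lambda>g. the (g xs)) gs) = Suc y"
    using approximatesD(3)[OF F _ zs(2)] by simp
  moreover have "\<forall>\<^sub>F t in sequentially. \<forall>g\<in>set gs. H g (t # xs) = Suc (the (g xs))"
    by (intro eventually_ball_finite finite_set ballI approximatesD(3)[OF H xs g])
  ultimately show "\<forall>\<^sub>F t in sequentially. (if \<forall>g\<in>set gs. 0 < H g (t # xs)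
    then F ((t # xs) ! 0 # map (\<lambda>g. H g (t # xs) - 1) gs) else 0) = Suc y"
  proof eventually_elim
    case (elim t)
    then show ?case by (simp cong: map_cong)
  qed
qed

text \<open>Every round of the recursion receives the same step bound, and a \<open>0\<close> from
  an unfinished round is passed on. For a fixed recursion argument only finitely many rounds occur,
  so a large enough bound serves them all.\<close>

lemma approximates_prec:
  assumes F: "approximates k f F" and H: "approximates (Suc (Suc k)) g H"
  shows "approximates (Suc k)
    (\<lambda>xs. rec_nat (f (tl xs)) (\<lambda>m r. Option.bind r (\<lambda>y. g (m # y # tl xs))) (hd xs))
    (\<lambda>ys. rec_nat (F (ys ! 0 # drop 2 ys))
      (\<lambda>m r. if 0 < r then H (ys ! 0 # m # (r - 1) # drop 2 ys) else 0) (ys ! 1))"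
  (is "approximates _ ?f ?F")
proof (rule approximatesI)
  \<comment> \<open>The entries of \<open>zs\<close> are the counter, the running value, the step
    bound and the recursion argument, followed by the parameters.\<close>
  have "tot (4 + k) (\<lambda>zs. H (zs ! 2 # zs ! 0 # (zs ! 1 - 1) # drop 4 zs))"
    using tot_append_drop[of "[\<lambda>zs. zs ! 2, \<lambda>zs. zs ! 0, \<lambda>zs. zs ! 1 - 1]" k H 4]
      approximatesD(1)[OF H]
    by (simp add: tot_nth tot_diff tot_const)
  then have "tot (Suc (Suc (Suc (Suc k))))
    (\<lambda>zs. H (tl (tl zs) ! 0 # zs ! 0 # (zs ! 1 - 1) # drop 2 (tl (tl zs))))"
    by (auto elim!: tot_cong simp: nth_tl drop_Suc eval_nat_numeral)
  moreover have "tot (2 + k) (\<lambda>ys. F (ys ! 0 # drop 2 ys))"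
    using tot_append_drop[of "[\<lambda>ys. ys ! 0]" k F 2] approximatesD(1)[OF F] tot_nth by simp
  ultimately show "tot (Suc (Suc k)) ?F"
    by (intro tot_rec_nat tot_if dec_less tot_const tot_nth) auto
next
  fix xs t y
  assume "length xs = Suc k" and eq: "?F (t # xs) = Suc y"
  then obtain n ys where xs: "xs = n # ys" "length ys = k" by (cases xs) auto
  let ?r = "rec_nat (F (t # ys)) (\<lambda>m r. if 0 < r then H (t # m # (r - 1) # ys) else 0)"
  let ?p = "rec_nat (f ys) (\<lambda>m r. Option.bind r (\<lambda>y. g (m # y # ys)))"
  have "?r n = Suc y \<Longrightarrow> ?p n = Some y"
  proof (induction n arbitrary: y)
    case 0
    then show ?case using approximatesD(2)[OF F xs(2)] by simp
  next
    case (Suc n)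
    then obtain z where z: "?r n = Suc z" by (cases "?r n") auto
    with Suc have "?p n = Some z" "H (t # n # z # ys) = Suc y" by auto
    then show ?case
      using approximatesD(2)[OF H, of "n # z # ys" t y] xs(2) by simp
  qed
  then show "?f xs = Some y" using eq xs by (simp cong: if_cong)
next
  fix xs y
  assume "length xs = Suc k" and eq: "?f xs = Some y"
  then obtain n ys where xs: "xs = n # ys" "length ys = k" by (cases xs) auto
  let ?r = "\<lambda>t. rec_nat (F (t # ys)) (\<lambda>m r. if 0 < r then H (t # m # (r - 1) # ys) else 0)"
  let ?p = "rec_nat (f ys) (\<lambda>m r. Option.bind r (\<lambda>y. g (m # y # ys)))"
  have "?p n = Some y \<Longrightarrow> \<forall>\<^sub>F t in sequentially. ?r t n = Suc y"
  proof (induction n arbitrary: y)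
    case 0
    then show ?case using approximatesD(3)[OF F xs(2)] by simp
  next
    case (Suc n)
    then obtain z where z: "?p n = Some z" "g (n # z # ys) = Some y"
      by (auto simp: bind_eq_Some_conv)
    have "\<forall>\<^sub>F t in sequentially. H (t # n # z # ys) = Suc y"
      using approximatesD(3)[OF H _ z(2)] xs(2) by simp
    with Suc.IH[OF z(1)] show ?case
      by eventually_elim simp
  qed
  then show "\<forall>\<^sub>F t in sequentially. ?F (t # xs) = Suc y" using eq xs by (simp cong: if_cong)
qed

text \<open>The zero provided by the existential may not be the least one, but it bounds the least
  one from above, so definedness at all earlier arguments carries over.\<close>

lemma minim_eq_Some:
  fixes f :: "nat \<Rightarrow> nat option"
  shows "(if \<exists>n. f n = Some 0 \<and> (\<forall>m<n. f m \<noteq> None) then Some (LEAST n. f n = Some 0) else None) = Some n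
    \<longleftrightarrow> f n = Some 0 \<and> (\<forall>m<n. \<exists>y. f m = Some (Suc y))" (is "?l \<longleftrightarrow> ?r")
proof
  assume ?l
  then obtain n' where n': "f n' = Some 0" "\<forall>m<n'. f m \<noteq> None" and n: "n = (LEAST n. f n = Some 0)"
    by (auto split: if_splits)
  have "f n = Some 0" "n \<le> n'"
    using n'(1) LeastI[of "\<lambda>n. f n = Some 0"] Least_le[of "\<lambda>n. f n = Some 0"] by (auto simp: n)
  moreover have "\<exists>y. f m = Some (Suc y)" if "m < n" for m
    using n'(2) \<open>n \<le> n'\<close> that not_less_Least[of m "\<lambda>n. f n = Some 0"]
    by (cases "f m"; cases "the (f m)") (auto simp: n)
  ultimately show ?r by blast
next
  assume r: ?r
  then have "(LEAST n. f n = Some 0) = n"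
    by (intro Least_equality) (auto simp: not_less[symmetric])
  moreover have "\<exists>n. f n = Some 0 \<and> (\<forall>m<n. f m \<noteq> None)"
    using r by (metis option.distinct(1))
  ultimately show ?l by simp
qed

text \<open>The bound \<open>t\<close> limits both the computation steps and the range of the
  search. Once it exceeds the answer and all values up to the answer have been computed, the search
  succeeds.\<close>

lemma approximates_minim:
  assumes F: "approximates (Suc k) f F"
  shows "approximates k (\<lambda>xs. if \<exists>n. f (n # xs) = Some 0 \<and> (\<forall>m<n. f (m # xs) \<noteq> None)
      then Some (LEAST n. f (n # xs) = Some 0) else None)
    (\<lambda>ys. bounded_search
      (\<lambda>n. F (ys ! 0 # n # drop 1 ys) = 1 \<and> (\<forall>m<n. 1 < F (ys ! 0 # m # drop 1 ys))) (ys ! 0))"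
  (is "approximates _ ?f (\<lambda>ys. bounded_search (?Q ys) _)")
proof (rule approximatesI)
  have "tot (2 + k) (\<lambda>zs. F (zs ! 1 # zs ! 0 # drop 2 zs))"
    using tot_append_drop[of "[\<lambda>zs. zs ! 1, \<lambda>zs. zs ! 0]" k F 2] approximatesD(1)[OF F]
    by (simp add: tot_nth)
  then have *: "tot (Suc (Suc k)) (\<lambda>zs. F (tl zs ! 0 # zs ! 0 # drop 1 (tl zs)))"
    by (auto elim!: tot_cong simp: nth_tl drop_Suc eval_nat_numeral)
  have "tot (3 + k) (\<lambda>zs. F (zs ! 2 # zs ! 0 # drop 3 zs))"
    using tot_append_drop[of "[\<lambda>zs. zs ! 2, \<lambda>zs. zs ! 0]" k F 3] approximatesD(1)[OF F]
    by (simp add: tot_nth)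
  then have "tot (Suc (Suc (Suc k))) (\<lambda>zs. F (tl (tl zs) ! 0 # zs ! 0 # drop 1 (tl (tl zs))))"
    by (auto elim!: tot_cong simp: nth_tl drop_Suc eval_nat_numeral)
  with * show "tot (Suc k) (\<lambda>ys. bounded_search (?Q ys) (ys ! 0))"
    by (intro tot_bounded_search dec_conj dec_all_less dec_less dec_eq tot_const tot_nth) auto
next
  fix xs t n
  assume xs: "length xs = k" and eq: "bounded_search (?Q (t # xs)) ((t # xs) ! 0) = Suc n"
  then have Q: "F (t # n # xs) = 1" "\<And>m. m < n \<Longrightarrow> 1 < F (t # m # xs)"
    by (simp_all add: bounded_search_first_eq_Suc)
  have "\<exists>y. f (m # xs) = Some (Suc y)" if m: "m < n" for m
  proof -
    have "F (t # m # xs) = Suc (Suc (F (t # m # xs) - 2))"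
      using Q(2)[OF m] by arith
    then show ?thesis using approximatesD(2)[OF F, of "m # xs" t] xs by auto
  qed
  with Q show "?f xs = Some n"
    using approximatesD(2)[OF F, of "n # xs" t 0] xs by (subst minim_eq_Some) simp
next
  fix xs n
  assume xs: "length xs = k" and eq: "?f xs = Some n"
  then have n: "f (n # xs) = Some 0" and "\<forall>m<n. \<exists>y. f (m # xs) = Some (Suc y)"
    by (subst (asm) minim_eq_Some; blast)+
  then obtain h where h: "\<And>m. m < n \<Longrightarrow> f (m # xs) = Some (Suc (h m))" by metis
  have "\<forall>\<^sub>F t in sequentially. \<forall>m\<in>{..<n}. F (t # m # xs) = Suc (Suc (h m))"
    using approximatesD(3)[OF F _ h] xs by (intro eventually_ball_finite) auto
  moreover have "\<forall>\<^sub>F t in sequentially. F (t # n # xs) = Suc 0"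
    using approximatesD(3)[OF F _ n] xs by simp
  moreover have "\<forall>\<^sub>F t in sequentially. n < t" by (rule eventually_gt_at_top)
  ultimately show "\<forall>\<^sub>F t in sequentially. bounded_search (?Q (t # xs)) ((t # xs) ! 0) = Suc n"
    by eventually_elim (simp add: bounded_search_first_eq_Suc)
qed

lemma approximableI: "approximates k f G \<Longrightarrow> \<exists>G. approximates k f G"
  by blast

text \<open>This takes the place of a normal form theorem: computations with a step bound are built
  by induction on the Kleene rules, without coding machines.\<close>

lemma partrec_approximable: "partrec k f \<Longrightarrow> \<exists>G. approximates k f G"
proof (induction rule: partrec.induct)
  case (zero k)
  then show ?case using approximates_total tot_const by blast
next
  case succ
  then show ?case using approximates_total[OF tot_Suc[OF tot_nth[of 0 1]]] by auto
next
  case (proj i k)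
  then show ?case using approximates_total[OF tot_nth] by blast
next
  case (comp gs f k)
  then obtain F where F: "approximates (length gs) f F" by blast
  have "\<forall>g\<in>set gs. \<exists>H. approximates k g H" using comp.IH by blast
  then obtain H where "\<forall>g\<in>set gs. approximates k g (H g)" by (auto dest: bchoice)
  then have "approximates k g (H g)" if "g \<in> set gs" for g using that by blast
  with F show ?case by (intro approximableI[OF approximates_comp])
next
  case (prec k f g)
  then obtain F G where "approximates k f F" "approximates (Suc (Suc k)) g G" by blast
  from approximableI[OF approximates_prec[OF this]] show ?case .
next
  case (minim k f)
  then obtain F where "approximates (Suc k) f F" by blast
  from approximableI[OF approximates_minim[OF this]] show ?case .
next
  case (cong k f g)
  then show ?case by (simp add: approximates_def)
qed


section \<open>Machines described by decidable enumerations of their graphs\<close>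

lemma dec_app3:
  "dec 3 (\<lambda>xs. R (xs ! 0) (xs ! 1) (xs ! 2)) \<Longrightarrow> tot k f \<Longrightarrow> tot k g \<Longrightarrow> tot k h \<Longrightarrow>
    dec k (\<lambda>xs. R (f xs) (g xs) (h xs))"
  by (rule tot_app3[where f = "\<lambda>a b c. of_bool (R a b c)"])

definition enumerates_graph :: "(nat \<Rightarrow> nat \<Rightarrow> nat \<Rightarrow> bool) \<Rightarrow> (str \<Rightarrow> str option) \<Rightarrow> bool" where
  "enumerates_graph R C \<longleftrightarrow> dec 3 (\<lambda>xs. R (xs ! 0) (xs ! 1) (xs ! 2)) \<and>
    (\<forall>x s. C x = Some s \<longleftrightarrow> (\<exists>t. R t (nat_of_str s) (nat_of_str x)))"

text \<open>Minimisation finds a common bound \<open>n\<close> for a stage and an output, and a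
  bounded search then recovers the output. Using one bound for both replaces a pairing
  function.\<close>

lemma partial_recursiveI:
  assumes R: "dec 3 (\<lambda>xs. R (xs ! 0) (xs ! 1) (xs ! 2))"
    and C: "\<And>x s. C x = Some s \<longleftrightarrow> (\<exists>t. R t (nat_of_str s) (nat_of_str x))"
  shows "partial_recursive C"
proof -
  let ?Q = "\<lambda>n x. \<exists>t\<le>n. \<exists>s\<le>n. R t s x"
  let ?out = "\<lambda>n x. bounded_search (\<lambda>s. \<exists>t\<le>n. R t s x) (Suc n) - 1"
  let ?M = "\<lambda>xs. if \<exists>n. ?Q n (xs ! 0) then Some (LEAST n. ?Q n (xs ! 0)) else None"
  \<comment> \<open>Minimisation looks for zeros, so it is applied to the indicator of the
    negation.\<close>
  have "dec 2 (\<lambda>xs. \<not> ?Q (xs ! 0) (xs ! 1))"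
    by (intro dec_not dec_ex_le dec_app3[OF R] tot_nth tot_nth_tl) simp_all
  then have "partrec (Suc 1) (\<lambda>xs. Some (of_bool (\<not> ?Q (xs ! 0) (xs ! 1))))"
    by (simp add: tot_def numeral_2_eq_2)
  from partrec.minim[OF this] have M: "partrec 1 ?M" by (simp cong: if_cong)
  have "tot 2 (\<lambda>xs. ?out (xs ! 0) (xs ! 1))"
    by (intro tot_diff tot_bounded_search tot_Suc dec_ex_le dec_app3[OF R] tot_nth tot_nth_tl tot_const)
      simp_all
  then have out: "partrec (length [?M, \<lambda>xs. Some (xs ! 0)]) (\<lambda>xs. Some (?out (xs ! 0) (xs ! 1)))"
    by (simp add: tot_def numeral_2_eq_2)
  define f where "f = (\<lambda>xs. Option.bind (those (map (\<lambda>g. g xs) [?M, \<lambda>xs. Some (xs ! 0)]))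
    (\<lambda>xs. Some (?out (xs ! 0) (xs ! 1))))"
  have "partrec 1 f"
    unfolding f_def using M by (intro partrec.comp[OF out]) (auto intro: partrec.proj)
  moreover have "f [nat_of_str x] = map_option nat_of_str (C x)" for x
  proof (cases "C x")
    case None
    \<comment> \<open>Every number codes a string, so any \<open>s\<close> related to
      \<open>x\<close> would be an output of \<open>C\<close>.\<close>
    then have "\<not> R t s (nat_of_str x)" for t s
      using C[of x "inv nat_of_str s"] bij_nat_of_str by (auto simp: bij_is_surj surj_f_inv_f)
    then show ?thesis using None by (simp add: f_def)
  next
    case (Some s)
    have uniq: "r = nat_of_str s" if "R t r (nat_of_str x)" for t r
    proof -
      have "r = nat_of_str (inv nat_of_str r)"
        using bij_nat_of_str by (simp add: bij_is_surj surj_f_inv_f)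
      then show ?thesis using C[of x "inv nat_of_str r"] that Some by auto
    qed
    obtain t where t: "R t (nat_of_str s) (nat_of_str x)" using C Some by blast
    then have ex: "?Q (max t (nat_of_str s)) (nat_of_str x)" by (meson max.cobounded1 max.cobounded2)
    define n where "n = (LEAST n. ?Q n (nat_of_str x))"
    have "?Q n (nat_of_str x)"
      unfolding n_def by (rule LeastI[where P = "\<lambda>n. ?Q n (nat_of_str x)", OF ex])
    then have "bounded_search (\<lambda>s. \<exists>t\<le>n. R t s (nat_of_str x)) (Suc n) = Suc (nat_of_str s)"
      using uniq by (subst bounded_search_eq_Suc) (auto simp: less_Suc_eq_le)
    moreover have "\<exists>n. ?Q n (nat_of_str x)" using ex by (rule exI)
    ultimately show ?thesis using Some by (simp add: f_def n_def)
  qed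
  ultimately show ?thesis by (auto simp: partial_recursive_def)
qed

text \<open>The stage is the step bound of an approximation: an output is listed at every stage at
  which it has been found.\<close>

lemma partial_recursive_graph:
  assumes "partial_recursive C"
  shows "\<exists>R. enumerates_graph R C"
proof -
  obtain f where f: "partrec 1 f" "\<And>p. f [nat_of_str p] = map_option nat_of_str (C p)"
    using assms by (auto simp: partial_recursive_def)
  obtain G where G: "approximates 1 f G" using partrec_approximable[OF f(1)] by blast
  show ?thesis
    unfolding enumerates_graph_def
  proof (intro exI conjI allI)
    have "tot 3 (\<lambda>xs. G (map (\<lambda>g. g xs) [\<lambda>xs. xs ! 0, \<lambda>xs. xs ! 2]))"
      using approximatesD(1)[OF G] by (intro tot_comp) (auto intro: tot_nth)
    then show "dec 3 (\<lambda>xs. G [xs ! 0, xs ! 2] = Suc (xs ! 1))"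
      by (intro dec_eq tot_Suc tot_nth) simp_all
    fix x s
    have "C x = Some s \<longleftrightarrow> f [nat_of_str x] = Some (nat_of_str s)"
      using bij_nat_of_str by (cases "C x") (auto simp: f(2) bij_is_inj inj_eq)
    also have "\<dots> \<longleftrightarrow> (\<exists>t. G [t, nat_of_str x] = Suc (nat_of_str s))"
      using approximatesD(2,3)[OF G, of "[nat_of_str x]"]
      by (auto simp: eventually_sequentially) blast
    finally show "C x = Some s \<longleftrightarrow> (\<exists>t. G [t, nat_of_str x] = Suc (nat_of_str s))" .
  qed
qed

lemma ex_function_of_relation:
  assumes "\<And>x s s'. W x s \<Longrightarrow> W x s' \<Longrightarrow> s = s'"
  shows "\<exists>C. \<forall>x s. C x = Some s \<longleftrightarrow> W x s"
proof (intro exI allI)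
  fix x s
  show "(if \<exists>s. W x s then Some (THE s. W x s) else None) = Some s \<longleftrightarrow> W x s"
    using assms theI[of "W x"] by (auto split: if_splits)
qed

section \<open>Strings, tagged programs and thinned machines\<close>

lemma nat_of_str_append: "nat_of_str (u @ p) = nat_of_str u * 2 ^ length p + nat_of_str p"
  by (induction p rule: rev_induct)
    (auto simp: nat_of_str_snoc append_assoc[symmetric] algebra_simps simp del: append_assoc)

lemma nat_of_str_bounds:
  "2 ^ length p \<le> nat_of_str p + 1 \<and> nat_of_str p + 1 < 2 ^ Suc (length p)"
  by (induction p rule: rev_induct) (auto simp: nat_of_str_snoc)

text \<open>With a leading 1 the string becomes \<open>j + 1\<close> ones and a zero, in binary
  \<open>2 ^ (j + 2) - 2\<close>; the code is one less.\<close>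

lemma nat_of_str_True_False: "nat_of_str (replicate j True @ [False]) = 2 ^ (j + 2) - 3"
proof -
  have "nat_of_str (replicate j True) + 2 = 2 ^ Suc j"
    by (induction j) (auto simp: nat_of_str_snoc replicate_append_same[symmetric])
  then show ?thesis by (simp add: nat_of_str_snoc)
qed

text \<open>String length in arithmetical form: \<open>n + 1\<close> is the binary number
  \<open>1s\<close>, which has \<open>l + 1\<close> digits. This makes length decidable on
  codes.\<close>

definition has_length :: "nat \<Rightarrow> nat \<Rightarrow> bool" where
  "has_length l n \<longleftrightarrow> 2 ^ l \<le> n + 1 \<and> n + 1 < 2 ^ Suc l"

lemma has_length_unique:
  assumes "has_length l n" "has_length l' n" shows "l = l'"
proof -
  have "(2::nat) ^ l < 2 ^ Suc l'" "(2::nat) ^ l' < 2 ^ Suc l"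
    using assms unfolding has_length_def by linarith+
  then show ?thesis by (simp only: power_strict_increasing_iff[of "2::nat"])
qed

lemma has_length_iff: "has_length l (nat_of_str p) \<longleftrightarrow> length p = l"
  using nat_of_str_bounds[of p] has_length_unique by (auto simp: has_length_def)

lemma has_length_le: "has_length l n \<Longrightarrow> l \<le> n"
  using less_exp[of l] unfolding has_length_def by linarith

lemma dec_has_length: "tot k f \<Longrightarrow> tot k g \<Longrightarrow> dec k (\<lambda>xs. has_length (f xs) (g xs))"
  unfolding has_length_def
  by (intro dec_conj dec_le dec_less tot_power2 tot_add tot_Suc tot_const)

lemma length_le_nat_of_str: "length p \<le> nat_of_str p"
  using has_length_le has_length_iff by blast

lemma nat_of_str_eq_iff [simp]: "nat_of_str s = nat_of_str t \<longleftrightarrow> s = t"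
  using bij_nat_of_str by (simp add: bij_is_inj inj_eq)

lemma nat_of_str_str_of_nat [simp]: "nat_of_str (str_of_nat n) = n"
  unfolding str_of_nat_def using bij_nat_of_str by (simp add: bij_is_surj surj_f_inv_f)

lemma complexity_le: "C p = Some s \<Longrightarrow> complexity C s \<le> enat (length p)"
  unfolding complexity_def by (rule Inf_lower) auto

lemma complexity_attained:
  assumes "complexity C s \<noteq> \<infinity>"
  obtains p where "C p = Some s" "complexity C s = enat (length p)"
proof -
  let ?A = "{enat (length p) | p. C p = Some s}"
  have "?A \<noteq> {}"
  proof
    assume "?A = {}"
    then have "complexity C s = \<infinity>" by (simp only: complexity_def Inf_enat_def) simp
    with assms show False by contradiction
  qed
  then have "Inf ?A \<in> ?A" by (metis (no_types, lifting) ex_in_conv wellorder_InfI)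
  then show thesis using that by (auto simp: complexity_def)
qed


section \<open>Transforming programs behind a self-delimiting tag\<close>

lemma dec_app5:
  assumes "dec 5 (\<lambda>xs. R (xs ! 0) (xs ! 1) (xs ! 2) (xs ! 3) (xs ! 4))"
    and "tot k f" "tot k g" "tot k h" "tot k i" "tot k j"
  shows "dec k (\<lambda>xs. R (f xs) (g xs) (h xs) (i xs) (j xs))"
  using tot_comp[of "[f, g, h, i, j]" "\<lambda>xs. of_bool (R (xs ! 0) (xs ! 1) (xs ! 2) (xs ! 3) (xs ! 4))" k]
    assms by (auto simp: eval_nat_numeral)

lemma obtain_nat_of_str: obtains s where "n = nat_of_str s"
  by (metis nat_of_str_str_of_nat)

lemma nat_of_str_le_append: "nat_of_str p \<le> nat_of_str (u @ p)" "nat_of_str u \<le> nat_of_str (u @ p)"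
  by (simp_all add: nat_of_str_append trans_le_add1)

lemma replicate_True_False_eq_iff:
  "replicate j True @ False # p = replicate j' True @ False # q \<longleftrightarrow> j = j' \<and> p = q"
proof (induction j arbitrary: j')
  case 0
  then show ?case by (cases j') auto
next
  case (Suc j)
  then show ?case by (cases j') auto
qed

text \<open>A machine reads \<open>1 ^ j 0 p\<close>, runs \<open>U\<close> on \<open>p\<close>, and
  converts the output using \<open>j\<close> and \<open>length p\<close>. The tag is
  self-delimiting, so the domain stays prefix-free, and optimality of \<open>U\<close> bounds the
  overhead. Since \<open>\<Phi>\<close> has a stage argument, the conversion itself may involve an
  unbounded search.\<close>

lemma complexity_le_tagged:
  assumes U: "optimal U"
    and Phi: "dec 5 (\<lambda>xs. \<Phi> (xs ! 0) (xs ! 1) (xs ! 2) (xs ! 3) (xs ! 4))"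
    and unique: "\<And>t t' j l y z z'. \<Phi> t j l y z \<Longrightarrow> \<Phi> t' j l y z' \<Longrightarrow> z = z'"
  shows "\<exists>c. \<forall>j p s t z. U p = Some s \<longrightarrow> \<Phi> t j (length p) (nat_of_str s) (nat_of_str z) \<longrightarrow>
    complexity U z \<le> enat (length p + j + c)"
proof -
  have U': "partial_recursive U" "prefix_free (dom U)"
    using U by (auto simp: optimal_def prefix_free_machine_def)
  obtain R where R: "dec 3 (\<lambda>xs. R (xs ! 0) (xs ! 1) (xs ! 2))"
    and UR: "\<And>x s. U x = Some s \<longleftrightarrow> (\<exists>t. R t (nat_of_str s) (nat_of_str x))"
    using partial_recursive_graph[OF U'(1)] unfolding enumerates_graph_def by (elim exE conjE) blast
  let ?tag = "\<lambda>j. replicate j True @ [False]"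
  define W where "W = (\<lambda>x z. \<exists>j p s t. x = ?tag j @ p \<and> U p = Some s \<and>
    \<Phi> t j (length p) (nat_of_str s) (nat_of_str z))"
  have "z = z'" if W: "W x z" "W x z'" for x z z'
    using W unique unfolding W_def by (fastforce simp: replicate_True_False_eq_iff)
  then obtain D where D: "\<And>x z. D x = Some z \<longleftrightarrow> W x z"
    using ex_function_of_relation[of W] by blast
  \<comment> \<open>A decidable form of \<open>W\<close> on codes: the parts of the input are
    bounded by \<open>x\<close>, while the intermediate output and both stages are bounded by the
    common stage \<open>t\<close>.\<close>
  define RD where "RD = (\<lambda>t z x. \<exists>j\<le>x. \<exists>p\<le>x. \<exists>l\<le>x. \<exists>y\<le>t. \<exists>t1\<le>t. \<exists>t2\<le>t.
    has_length l p \<and> x = (2 ^ (j + 2) - 3) * 2 ^ l + p \<and> R t1 y p \<and> \<Phi> t2 j l y z)"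
  have "partial_recursive D"
  proof (rule partial_recursiveI)
    show "dec 3 (\<lambda>xs. RD (xs ! 0) (xs ! 1) (xs ! 2))"
      unfolding RD_def
      by (intro dec_ex_le dec_conj dec_has_length dec_eq dec_app3[OF R] dec_app5[OF Phi]
          tot_add tot_mult tot_diff tot_power2 tot_const tot_nth tot_nth_tl) simp_all
    fix x z
    show "D x = Some z \<longleftrightarrow> (\<exists>t. RD t (nat_of_str z) (nat_of_str x))"
      unfolding D
    proof
      assume "W x z"
      then obtain j p s t where x: "x = ?tag j @ p" and p: "U p = Some s"
        and z: "\<Phi> t j (length p) (nat_of_str s) (nat_of_str z)"
        unfolding W_def by blast
      obtain t1 where t1: "R t1 (nat_of_str s) (nat_of_str p)" using p UR by blast
      have "j \<le> nat_of_str x" "length p \<le> nat_of_str x"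
        using length_le_nat_of_str[of x] by (auto simp: x)
      moreover have "nat_of_str p \<le> nat_of_str x"
        unfolding x by (rule nat_of_str_le_append)
      moreover have "nat_of_str x = (2 ^ (j + 2) - 3) * 2 ^ length p + nat_of_str p"
        unfolding x nat_of_str_append[of "?tag j"] nat_of_str_True_False ..
      moreover have "has_length (length p) (nat_of_str p)" by (simp add: has_length_iff)
      moreover have "\<exists>t'. nat_of_str s \<le> t' \<and> t1 \<le> t' \<and> t \<le> t'"
        by (rule exI[of _ "nat_of_str s + t1 + t"]) simp
      ultimately show "\<exists>t. RD t (nat_of_str z) (nat_of_str x)"
        using t1 z unfolding RD_def by blast
    next
      assume "\<exists>t. RD t (nat_of_str z) (nat_of_str x)"
      then obtain j n l y t1 t2 where *: "has_length l n" "nat_of_str x = (2 ^ (j + 2) - 3) * 2 ^ l + n"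
        "R t1 y n" "\<Phi> t2 j l y (nat_of_str z)"
        unfolding RD_def by blast
      obtain p where n: "n = nat_of_str p" by (rule obtain_nat_of_str)
      obtain s where y: "y = nat_of_str s" by (rule obtain_nat_of_str)
      have l: "l = length p" using *(1) n has_length_iff by simp
      have "nat_of_str x = nat_of_str (?tag j @ p)"
        unfolding *(2) nat_of_str_append[of "?tag j"] nat_of_str_True_False n l ..
      then have "x = ?tag j @ p" by (simp only: nat_of_str_eq_iff)
      moreover have "U p = Some s" using *(3) UR n y by blast
      ultimately show "W x z"
        using *(4) unfolding W_def n y l by blast
    qed
  qed
  moreover have "prefix_free (dom D)"
    unfolding prefix_free_def
  proof (intro ballI notI)
    fix x x' assume "x \<in> dom D" "x' \<in> dom D" and xx': "strict_prefix x x'"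
    then obtain z z' where "W x z" "W x' z'" using D by blast
    then obtain j p j' p' where x: "x = ?tag j @ p" "x' = ?tag j' @ p'" and p: "p \<in> dom U" "p' \<in> dom U"
      unfolding W_def by blast
    obtain r where r: "x' = x @ r" "r \<noteq> []"
      using xx' by (auto simp: strict_prefix_def prefix_def)
    then have "p' = p @ r"
      using x replicate_True_False_eq_iff[of j "p @ r" j' p'] by simp
    then have "strict_prefix p p'" using r(2) by (simp add: strict_prefix_def)
    with p U'(2) show False unfolding prefix_free_def by blast
  qed
  ultimately obtain d where d: "\<And>z. complexity U z \<le> complexity D z + enat d"
    using U unfolding optimal_def prefix_free_machine_def by blast
  \<comment> \<open>The \<open>1\<close> pays for the zero that closes the tag, and \<open>d\<close>
    for the simulation by \<open>U\<close>.\<close>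
  have "complexity U z \<le> enat (length p + j + (1 + d))"
    if "U p = Some s" "\<Phi> t j (length p) (nat_of_str s) (nat_of_str z)" for j p s t z
  proof -
    have "D (?tag j @ p) = Some z" using that unfolding D W_def by blast
    from complexity_le[of D, OF this] have "complexity D z \<le> enat (length p + j + 1)"
      by (simp add: add.commute)
    then have "complexity D z + enat d \<le> enat (length p + j + 1) + enat d"
      by (rule add_right_mono)
    with d[of z] show ?thesis by (auto elim: order_trans)
  qed
  then show ?thesis by blast
qed

section \<open>One surviving program for each length and output\<close>

definition same_length :: "nat \<Rightarrow> nat \<Rightarrow> bool" where
  "same_length p q \<longleftrightarrow> (\<exists>l\<le>p. has_length l p \<and> has_length l q)"

text \<open>\<open>(t, p)\<close> is lexicographically least among the pairs with \<open>R t y p\<close> and \<open>p\<close> of the given length.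
  The bound \<open>2 * p\<close> covers all codes of strings as long as the one coded by \<open>p\<close>.\<close>

definition first_found :: "(nat \<Rightarrow> nat \<Rightarrow> nat \<Rightarrow> bool) \<Rightarrow> nat \<Rightarrow> nat \<Rightarrow> nat \<Rightarrow> bool" where
  "first_found R t y p \<longleftrightarrow> R t y p \<and>
    (\<forall>u<t. \<forall>q\<le>2 * p. same_length p q \<longrightarrow> \<not> R u y q) \<and>
    (\<forall>q<p. same_length p q \<longrightarrow> \<not> R t y q)"

lemma same_length_iff: "same_length (nat_of_str p) (nat_of_str q) \<longleftrightarrow> length p = length q"
  using length_le_nat_of_str[of p] by (auto simp: same_length_def has_length_iff)

text \<open>Codes of strings of length \<open>l\<close> range from \<open>2 ^ l - 1\<close> to
  \<open>2 * (2 ^ l - 1)\<close>.\<close>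

lemma same_length_le:
  assumes "length p = length q"
  shows "nat_of_str q \<le> 2 * nat_of_str p"
  using nat_of_str_bounds[of p] nat_of_str_bounds[of q] assms by simp

lemma dec_first_found:
  assumes "dec 3 (\<lambda>xs. R (xs ! 0) (xs ! 1) (xs ! 2))" "tot k f" "tot k g" "tot k h"
  shows "dec k (\<lambda>xs. first_found R (f xs) (g xs) (h xs))"
proof -
  have "dec 3 (\<lambda>xs. first_found R (xs ! 0) (xs ! 1) (xs ! 2))"
    unfolding first_found_def same_length_def
    by (intro dec_conj dec_all_le dec_all_less dec_ex_le dec_imp dec_not dec_has_length
        dec_app3[OF assms(1)] tot_mult tot_const tot_nth tot_nth_tl) simp_all
  then show ?thesis using assms(2-) by (rule dec_app3)
qed

text \<open>An earlier stage of one program would violate the first minimality clause for the other,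
  whose bound covers all codes of that length. So the stages agree, and the second clause compares
  the codes.\<close>

lemma first_found_unique:
  assumes "first_found R t y (nat_of_str p)" "first_found R u y (nat_of_str q)" "length p = length q"
  shows "p = q"
proof -
  have "\<not> t < u" "\<not> u < t"
    using assms same_length_le unfolding first_found_def by (metis same_length_iff)+
  then have "t = u" by simp
  then have "\<not> nat_of_str p < nat_of_str q" "\<not> nat_of_str q < nat_of_str p"
    using assms unfolding first_found_def by (metis same_length_iff)+
  then have "nat_of_str p = nat_of_str q" by simp
  then show ?thesis by simp
qed

text \<open>Minimise the stage over all programs of the given length first, and then the code at
  that stage.\<close>

lemma first_found_exists:
  assumes "R t y (nat_of_str p)"
  shows "\<exists>u q. length q = length p \<and> first_found R u y (nat_of_str q)"
proof -
  define P where "P = (\<lambda>u. \<exists>q. length q = length p \<and> R u y (nat_of_str q))"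
  define u where "u = (LEAST u. P u)"
  have "P t" using assms by (auto simp: P_def)
  then have "P u" unfolding u_def by (rule LeastI)
  define Q where "Q = (\<lambda>n. \<exists>q. n = nat_of_str q \<and> length q = length p \<and> R u y n)"
  define n where "n = (LEAST n. Q n)"
  have "\<exists>n. Q n" using \<open>P u\<close> by (auto simp: P_def Q_def)
  then have "Q n" unfolding n_def by (rule LeastI_ex)
  then obtain q where q: "n = nat_of_str q" "length q = length p" "R u y (nat_of_str q)"
    by (auto simp: Q_def)
  have "\<not> R v y m" if v: "v < u" and m: "same_length (nat_of_str q) m" for v m
  proof -
    obtain r where "m = nat_of_str r" by (rule obtain_nat_of_str)
    then show ?thesis
      using not_less_Least[of v P] v m q(2) by (auto simp: same_length_iff u_def P_def)
  qed
  moreover have "\<not> R u y m" if lt: "m < nat_of_str q" and m: "same_length (nat_of_str q) m" for m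
  proof -
    obtain r where "m = nat_of_str r" by (rule obtain_nat_of_str)
    then show ?thesis
      using not_less_Least[of m Q] lt m q(1,2) by (auto simp: same_length_iff n_def Q_def)
  qed
  ultimately have "first_found R u y (nat_of_str q)"
    using q(3) unfolding first_found_def by blast
  with q(2) show ?thesis by blast
qed

section \<open>Pairs on the level of codes, and the padded machine\<close>

definition pair_code :: "(str \<times> str \<Rightarrow> str) \<Rightarrow> nat \<Rightarrow> nat \<Rightarrow> nat" where
  "pair_code b m n = nat_of_str (b (str_of_nat m, str_of_nat n))"

lemma str_of_nat_nat_of_str [simp]: "str_of_nat (nat_of_str s) = s"
  by (metis nat_of_str_eq_iff nat_of_str_str_of_nat)

lemma str_of_nat_eq_iff [simp]: "str_of_nat m = str_of_nat n \<longleftrightarrow> m = n"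
  by (metis nat_of_str_str_of_nat)

lemma pair_code_nat_of_str: "pair_code b m (nat_of_str s) = nat_of_str (b (str_of_nat m, s))"
  by (simp add: pair_code_def)

lemma pair_code_eq_iff: "bij b \<Longrightarrow> pair_code b m n = pair_code b m' n' \<longleftrightarrow> m = m' \<and> n = n'"
  by (simp add: pair_code_def bij_is_inj inj_eq)

lemma tot_pair_code:
  assumes "total_recursive2 b" "tot k g" "tot k h"
  shows "tot k (\<lambda>xs. pair_code b (g xs) (h xs))"
proof -
  obtain f where f: "partrec 2 f"
    "\<And>s t. f [nat_of_str s, nat_of_str t] = Some (nat_of_str (b (s, t)))"
    using assms(1) unfolding total_recursive2_def by blast
  have "tot 2 (\<lambda>xs. pair_code b (xs ! 0) (xs ! 1))"
    unfolding tot_def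
  proof (rule partrec.cong[OF f(1)])
    fix xs :: "nat list" assume "length xs = 2"
    then obtain m n where "xs = [m, n]" by (auto simp: numeral_2_eq_2 length_Suc_conv)
    then show "Some (pair_code b (xs ! 0) (xs ! 1)) = f xs"
      using f(2)[of "str_of_nat m" "str_of_nat n"] by (simp add: pair_code_def)
  qed
  then show ?thesis using assms(2,3) by (rule tot_app2)
qed

text \<open>If \<open>x\<close> is a prefix of \<open>x'\<close> and both are accepted, their
  surviving prefixes are comparable and hence equal, as \<open>U\<close> is prefix-free. The common
  output \<open>b (length x, s)\<close> records the length, so \<open>x\<close> and
  \<open>x'\<close> are equally long. The same argument shows that \<open>V\<close> is
  single-valued.\<close>

lemma padded_machine:
  assumes U: "prefix_free_machine U" and b: "bij b" "total_recursive2 b"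
  obtains S V where
    "\<And>p y. S p y \<Longrightarrow> U p = Some y"
    "\<And>p q y. S p y \<Longrightarrow> S q y \<Longrightarrow> length p = length q \<Longrightarrow> p = q"
    "\<And>p y. U p = Some y \<Longrightarrow> \<exists>q. length q = length p \<and> S q y"
    "prefix_free_machine V"
    "\<And>x s. V x = Some s \<longleftrightarrow> (\<exists>p. prefix p x \<and> S p (b (str_of_nat (length x), s)))"
proof -
  have U': "partial_recursive U" "prefix_free (dom U)"
    using U by (auto simp: prefix_free_machine_def)
  obtain R where R: "dec 3 (\<lambda>xs. R (xs ! 0) (xs ! 1) (xs ! 2))"
    and UR: "\<And>x s. U x = Some s \<longleftrightarrow> (\<exists>t. R t (nat_of_str s) (nat_of_str x))"
    using partial_recursive_graph[OF U'(1)] unfolding enumerates_graph_def by (elim exE conjE) blast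
  define S where "S = (\<lambda>p y. \<exists>t. first_found R t (nat_of_str y) (nat_of_str p))"
  define W where "W = (\<lambda>x s. \<exists>p. prefix p x \<and> S p (b (str_of_nat (length x), s)))"
  have SU: "U p = Some y" if "S p y" for p y
    using that UR unfolding S_def first_found_def by blast
  have prefix_eq: "p = q" if "prefix p x" "prefix q x" "S p y" "S q z" for p q x y z
  proof -
    have "\<not> strict_prefix p q" "\<not> strict_prefix q p"
      using U'(2) SU[OF that(3)] SU[OF that(4)] unfolding prefix_free_def by blast+
    then show ?thesis using prefix_same_cases[OF that(1,2)] by (auto simp: strict_prefix_def)
  qed
  have b_eq: "b x = b y \<longleftrightarrow> x = y" for x y using b(1) by (simp add: bij_is_inj inj_eq)
  have "s = s'" if W: "W x s" "W x s'" for x s s'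
  proof -
    obtain p q where pq: "prefix p x" "S p (b (str_of_nat (length x), s))"
      "prefix q x" "S q (b (str_of_nat (length x), s'))"
      using W unfolding W_def by blast
    then have "p = q" using prefix_eq by blast
    then show ?thesis using SU[OF pq(2)] SU[OF pq(4)] by (simp add: b_eq)
  qed
  then obtain V where V: "\<And>x s. V x = Some s \<longleftrightarrow> W x s"
    using ex_function_of_relation[of W] by blast
  have "prefix_free (dom V)"
    unfolding prefix_free_def
  proof (intro ballI notI)
    fix x x' assume "x \<in> dom V" "x' \<in> dom V" and xx': "strict_prefix x x'"
    then obtain s s' where "W x s" "W x' s'" using V by blast
    then obtain p q where pq: "prefix p x" "S p (b (str_of_nat (length x), s))"
      "prefix q x'" "S q (b (str_of_nat (length x'), s'))"
      unfolding W_def by blast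
    have "prefix p x'" using pq(1) xx' by (auto simp: strict_prefix_def)
    then have "p = q" using prefix_eq pq by blast
    then have "length x = length x'"
      using SU[OF pq(2)] SU[OF pq(4)] by (simp add: b_eq)
    with prefix_length_less[OF xx'] show False by simp
  qed
  moreover
  \<comment> \<open>Here \<open>p\<close> and \<open>q\<close> code the two parts of a splitting of
    the input and \<open>l\<close> is its full length; all of these are bounded by
    \<open>x\<close>.\<close>
  define RV where "RV = (\<lambda>t s x. \<exists>p\<le>x. \<exists>q\<le>x. \<exists>k\<le>x. \<exists>l\<le>x. has_length k q \<and> has_length l x \<and>
    x = p * 2 ^ k + q \<and> first_found R t (pair_code b l s) p)"
  have "partial_recursive V"
  proof (rule partial_recursiveI)
    show "dec 3 (\<lambda>xs. RV (xs ! 0) (xs ! 1) (xs ! 2))"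
      unfolding RV_def
      by (intro dec_ex_le dec_conj dec_has_length dec_eq dec_first_found[OF R] tot_pair_code[OF b(2)]
          tot_add tot_mult tot_power2 tot_const tot_nth tot_nth_tl) simp_all
    fix x s
    show "V x = Some s \<longleftrightarrow> (\<exists>t. RV t (nat_of_str s) (nat_of_str x))"
      unfolding V
    proof
      assume "W x s"
      then obtain p q t where x: "x = p @ q"
        and t: "first_found R t (pair_code b (length x) (nat_of_str s)) (nat_of_str p)"
        unfolding W_def S_def pair_code_nat_of_str prefix_def by blast
      have "length q \<le> nat_of_str x" "length x \<le> nat_of_str x"
        using length_le_nat_of_str[of x] by (auto simp: x)
      moreover have "has_length (length x) (nat_of_str x)" "has_length (length q) (nat_of_str q)"
        by (simp_all add: has_length_iff)
      moreover have "nat_of_str p \<le> nat_of_str x" "nat_of_str q \<le> nat_of_str x"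
        unfolding x by (rule nat_of_str_le_append)+
      moreover have "nat_of_str x = nat_of_str p * 2 ^ length q + nat_of_str q"
        unfolding x by (rule nat_of_str_append)
      ultimately show "\<exists>t. RV t (nat_of_str s) (nat_of_str x)"
        using t unfolding RV_def by blast
    next
      assume "\<exists>t. RV t (nat_of_str s) (nat_of_str x)"
      then obtain t m n k l where *: "has_length k n" "has_length l (nat_of_str x)"
        "nat_of_str x = m * 2 ^ k + n" "first_found R t (pair_code b l (nat_of_str s)) m"
        unfolding RV_def by blast
      obtain p where m: "m = nat_of_str p" by (rule obtain_nat_of_str)
      obtain q where n: "n = nat_of_str q" by (rule obtain_nat_of_str)
      have k: "k = length q" "l = length x" using *(1,2) n has_length_iff by auto
      have "nat_of_str x = nat_of_str (p @ q)"
        unfolding *(3) nat_of_str_append n m k ..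
      then have "prefix p x" by simp
      moreover have "S p (b (str_of_nat (length x), s))"
        using *(4) unfolding S_def pair_code_nat_of_str m k by blast
      ultimately show "W x s" unfolding W_def by blast
    qed
  qed
  ultimately have pf: "prefix_free_machine V" by (simp add: prefix_free_machine_def)
  have unique: "p = q" if S: "S p y" "S q y" "length p = length q" for p q y
  proof -
    obtain t where t: "first_found R t (nat_of_str y) (nat_of_str p)"
      using S(1) unfolding S_def by (elim exE)
    obtain u where u: "first_found R u (nat_of_str y) (nat_of_str q)"
      using S(2) unfolding S_def by (elim exE)
    from first_found_unique[OF t u S(3)] show ?thesis .
  qed
  have ex: "\<exists>q. length q = length p \<and> S q y" if p: "U p = Some y" for p y
  proof -
    obtain t where "R t (nat_of_str y) (nat_of_str p)" using p UR by blast
    from first_found_exists[of R, OF this] show ?thesis unfolding S_def by blast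
  qed
  have V_iff: "V x = Some s \<longleftrightarrow> (\<exists>p. prefix p x \<and> S p (b (str_of_nat (length x), s)))" for x s
    unfolding V W_def ..
  show thesis
    by (rule that[of S V]) (fact SU unique ex pf V_iff)+
qed

section \<open>Counting programs\<close>

lemma card_extensions:
  "card {x :: bool list. prefix p x \<and> length x = m} = (if length p \<le> m then 2 ^ (m - length p) else 0)"
proof (cases "length p \<le> m")
  case True
  let ?A = "{q :: bool list. set q \<subseteq> UNIV \<and> length q = m - length p}"
  have "{x. prefix p x \<and> length x = m} = (@) p ` ?A"
    using True by (auto simp: prefix_def)
  moreover have "card ((@) p ` ?A) = card ?A" by (intro card_image inj_onI) simp
  moreover have "card ?A = 2 ^ (m - length p)"
    using card_lists_length_eq[of "UNIV :: bool set" "m - length p"] by simp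
  ultimately show ?thesis using True by simp
next
  case False
  then have *: "{x. prefix p x \<and> length x = m} = {}" by (auto dest: prefix_length_le)
  show ?thesis unfolding * using False by simp
qed

text \<open>A geometric sum in \<open>i = m - l\<close>. For \<open>h > m\<close> the sum is empty,
  and \<open>powr\<close> with a possibly negative exponent lets one bound cover both cases.\<close>

lemma sum_power2_diff_le: "(\<Sum>l\<in>{h..m}. 2 ^ (m - l)) \<le> 2 powr (real m - real h + 1)"
proof (cases "h \<le> m")
  case True
  have "(\<Sum>l\<in>{h..m}. 2 ^ (m - l)) = (\<Sum>i<Suc (m - h). (2::real) ^ i)"
    by (rule sum.reindex_bij_witness[where i = "\<lambda>i. m - i" and j = "\<lambda>l. m - l"]) (use True in auto)
  also have "\<dots> \<le> 2 ^ Suc (m - h)"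
    by (subst geometric_sum) auto
  also have "\<dots> = 2 powr real (Suc (m - h))" by (subst powr_realpow) auto
  finally show ?thesis using True by (simp add: of_nat_diff add.commute)
qed auto

text \<open>The rate on the left is the square root of 2, which is below 3/2 because 9/4 exceeds 2.
  As 3/2 is still below 2, the later quotient 3/4 gives a convergent series.\<close>

lemma power2_half_le: "(2::real) ^ (k div 2) \<le> (3 / 2) ^ k"
proof (induction k rule: nat_less_induct)
  case (1 k)
  show ?case
  proof (cases "k < 2")
    case True
    then have "k = 0 \<or> k = 1" by auto
    then show ?thesis by auto
  next
    case False
    then obtain i where i: "k = Suc (Suc i)" using less_imp_Suc_add[of 1 k] by auto
    moreover have "(0::real) \<le> (3 / 2) ^ i" by simp
    \<comment> \<open>The inequality for \<open>i + 2\<close>, multiplied by 4.\<close>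
    ultimately have "8 * 2 ^ (i div 2) \<le> 9 * (3 / 2 :: real) ^ i"
      using "1.IH"[rule_format, of i] by linarith
    then show ?thesis by (simp add: i)
  qed
qed

lemma sum_power_three_quarters: "(\<Sum>m\<le>n. (3 / 4 :: real) ^ (n - m)) \<le> 4"
proof -
  have "(\<Sum>m\<le>n. (3 / 4 :: real) ^ (n - m)) = (\<Sum>k<Suc n. (3 / 4) ^ k)"
    by (rule sum.reindex_bij_witness[where i = "\<lambda>i. n - i" and j = "\<lambda>l. n - l"]) auto
  also have "\<dots> \<le> 4" by (subst geometric_sum) auto
  finally show ?thesis .
qed


section \<open>Growth of \<open>H(n, s)\<close> in \<open>n\<close>\<close>

lemma enat_pair_complexity:
  assumes "optimal U"
  shows "enat (pair_complexity U b n s) = complexity U (b (str_of_nat n, s))"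
  using optimal_complexity_finite[OF assms, of "b (str_of_nat n, s)"]
  by (auto simp: pair_complexity_def)

lemma pair_complexity_program:
  assumes "optimal U"
  obtains p where "U p = Some (b (str_of_nat n, s))" "length p = pair_complexity U b n s"
  using complexity_attained[OF optimal_complexity_finite[OF assms]] enat_pair_complexity[OF assms]
  by (metis enat.inject)

text \<open>The conversion sees \<open>length p\<close> and \<open>j\<close>, so it can attach the
  number \<open>length p + 2 * j\<close> to the output. The number grows by \<open>2 * j\<close>
  while the program grows by \<open>j\<close>, so a large \<open>j\<close> absorbs the
  constant.\<close>

lemma pair_complexity_length_le:
  assumes "optimal U" "total_recursive2 b"
  shows "\<exists>c. \<forall>j p s. U p = Some s \<longrightarrow> pair_complexity U b (length p + 2 * j) s \<le> length p + j + c"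
proof -
  have "dec 5 (\<lambda>xs. xs ! 4 = pair_code b (xs ! 2 + 2 * xs ! 1) (xs ! 3))"
    by (intro dec_eq tot_pair_code[OF assms(2)] tot_add tot_mult tot_const tot_nth) simp_all
  from complexity_le_tagged[OF assms(1), where \<Phi> = "\<lambda>t j l y z. z = pair_code b (l + 2 * j) y", OF this]
  show ?thesis
    by (simp add: pair_code_nat_of_str flip: enat_pair_complexity[OF assms(1)])
qed

lemma pair_complexity_shift:
  assumes "optimal U" "bij b" "total_recursive2 b"
  shows "\<exists>c. \<forall>j m s. pair_complexity U b (m + 2 * j + i) s \<le> pair_complexity U b m s + j + c"
proof -
  \<comment> \<open>The pairing \<open>b\<close> is inverted by a search bounded by the stage;
    injectivity makes the result independent of the stage.\<close>
  define \<Phi> where "\<Phi> = (\<lambda>t j (l::nat) y z. \<exists>m\<le>t. \<exists>n\<le>t. y = pair_code b m n \<and> z = pair_code b (m + 2 * j + i) n)"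
  have "dec 5 (\<lambda>xs. \<Phi> (xs ! 0) (xs ! 1) (xs ! 2) (xs ! 3) (xs ! 4))"
    unfolding \<Phi>_def
    by (intro dec_ex_le dec_conj dec_eq tot_pair_code[OF assms(3)] tot_add tot_mult tot_const tot_nth
        tot_nth_tl) simp_all
  moreover have "z = z'" if "\<Phi> t j l y z" "\<Phi> t' j l y z'" for t t' j l y z z'
    using that unfolding \<Phi>_def by (auto simp: pair_code_eq_iff[OF assms(2)])
  ultimately obtain c where c: "\<And>j p s t z. U p = Some s \<Longrightarrow>
      \<Phi> t j (length p) (nat_of_str s) (nat_of_str z) \<Longrightarrow> complexity U z \<le> enat (length p + j + c)"
    using complexity_le_tagged[OF assms(1), of \<Phi>] by blast
  have "pair_complexity U b (m + 2 * j + i) s \<le> pair_complexity U b m s + j + c" for j m s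
  proof -
    obtain p where p: "U p = Some (b (str_of_nat m, s))" "length p = pair_complexity U b m s"
      using pair_complexity_program[OF assms(1)] .
    have "\<Phi> (m + nat_of_str s) j (length p) (nat_of_str (b (str_of_nat m, s)))
      (nat_of_str (b (str_of_nat (m + 2 * j + i), s)))"
      unfolding \<Phi>_def pair_code_nat_of_str[symmetric]
      by (rule exI[of _ m], intro conjI, simp, rule exI[of _ "nat_of_str s"]) simp
    from c[OF p(1) this] show ?thesis
      by (simp add: p(2) flip: enat_pair_complexity[OF assms(1)])
  qed
  then show ?thesis by blast
qed

text \<open>Offsets 0 and 1 treat the two parities of \<open>n - m\<close>. The slope 1/2, being
  less than 1, is what makes the contributions of smaller \<open>m\<close> decay
  geometrically.\<close>

lemma pair_complexity_le:
  assumes "optimal U" "bij b" "total_recursive2 b"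
  shows "\<exists>c. \<forall>m n s. m \<le> n \<longrightarrow>
    pair_complexity U b n s \<le> pair_complexity U b m s + (n - m) div 2 + c"
proof -
  obtain c0 where c0: "\<And>j m s. pair_complexity U b (m + 2 * j) s \<le> pair_complexity U b m s + j + c0"
    using pair_complexity_shift[OF assms, of 0] by auto
  obtain c1 where c1: "\<And>j m s. pair_complexity U b (m + 2 * j + 1) s \<le> pair_complexity U b m s + j + c1"
    using pair_complexity_shift[OF assms, of 1] by blast
  have "pair_complexity U b n s \<le> pair_complexity U b m s + (n - m) div 2 + (c0 + c1)" if "m \<le> n" for m n s
  proof (cases "even (n - m)")
    case True
    then have "n = m + 2 * ((n - m) div 2)" using that by simp
    then show ?thesis using c0[of m "(n - m) div 2" s] by simp
  next
    case False
    then have "n = m + 2 * ((n - m) div 2) + 1" using that by presburger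
    then show ?thesis using c1[of m "(n - m) div 2" s] by simp
  qed
  then show ?thesis by blast
qed

section \<open>Optimality of the padded machine and the two counting bounds\<close>

theorem theorem13:
  fixes U :: "str \<Rightarrow> str option" and b :: "str \<times> str \<Rightarrow> str"
  assumes "optimal U"
    and "bij b"
    and "total_recursive2 b"
  shows "\<exists>V (d::nat). optimal V \<and>
    (\<forall>(n::nat) s. real (card (programs V n s))
        \<le> 2 powr (real n - real (pair_complexity U b n s) + real d)) \<and>
    (\<forall>(n::nat) s. real n - real (pair_complexity U b n s) \<ge> real d \<longrightarrow>
        2 powr (real n - real (pair_complexity U b n s) - real d)
          \<le> real (card (programs V n s)))"
proof -
  have U: "prefix_free_machine U" using assms(1) by (simp add: optimal_def)
  obtain S V where SU: "\<And>p y. S p y \<Longrightarrow> U p = Some y"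
    and S_unique: "\<And>p q y. S p y \<Longrightarrow> S q y \<Longrightarrow> length p = length q \<Longrightarrow> p = q"
    and S_ex: "\<And>p y. U p = Some y \<Longrightarrow> \<exists>q. length q = length p \<and> S q y"
    and V: "prefix_free_machine V"
    and V_iff: "\<And>x s. V x = Some s \<longleftrightarrow> (\<exists>p. prefix p x \<and> S p (b (str_of_nat (length x), s)))"
    using padded_machine[OF U assms(2,3)] by blast
  let ?h = "pair_complexity U b"
  have S_ge: "?h n s \<le> length p" if "S p (b (str_of_nat n, s))" for n s p
    using complexity_le[of U, OF SU[OF that]] by (simp flip: enat_pair_complexity[OF assms(1)])
  have S_shortest: "\<exists>p. length p = ?h n s \<and> S p (b (str_of_nat n, s))" for n s
    using pair_complexity_program[OF assms(1)] S_ex by metis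
  have fin: "finite (programs V n s)" for n s
    unfolding programs_def
    by (rule finite_subset[OF _ finite_lists_length_le[of UNIV n]]) auto
  have lower: "2 ^ (n - ?h n s) \<le> card (programs V n s)" if le: "?h n s \<le> n" for n s
  proof -
    obtain p where p: "length p = ?h n s" "S p (b (str_of_nat n, s))" using S_shortest by blast
    then have "{x. prefix p x \<and> length x = n} \<subseteq> programs V n s"
      unfolding programs_def using V_iff by auto
    from card_mono[OF fin this] show ?thesis
      unfolding card_extensions using le p(1) by simp
  qed
  have "optimal V"
    unfolding optimal_def
  proof (intro conjI allI impI V)
    fix C assume "prefix_free_machine C"
    then obtain d where d: "\<And>s. complexity U s \<le> complexity C s + enat d"
      using assms(1) unfolding optimal_def by blast
    obtain c where c: "\<And>j p s. U p = Some s \<Longrightarrow> ?h (length p + 2 * j) s \<le> length p + j + c"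
      using pair_complexity_length_le[OF assms(1,3)] by blast
    have "complexity V s \<le> complexity C s + enat (d + 2 * c)" for s
    proof -
      obtain p where p: "U p = Some s" "complexity U s = enat (length p)"
        using complexity_attained[OF optimal_complexity_finite[OF assms(1)]] .
      \<comment> \<open>Taking \<open>j = c\<close> gives
        \<open>?h ?n s \<le> length p + c + c = ?n\<close>, so the lower bound yields at least one
        program of length at most \<open>?n\<close>.\<close>
      let ?n = "length p + 2 * c"
      have "(0::nat) < 2 ^ (?n - ?h ?n s)" by simp
      also have "\<dots> \<le> card (programs V ?n s)"
        using c[OF p(1), of c] by (intro lower) simp
      finally have "0 < card (programs V ?n s)" .
      then obtain x where "V x = Some s" "length x \<le> ?n"
        by (force simp: card_gt_0_iff programs_def)
      then have "complexity V s \<le> enat ?n"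
        using complexity_le[of V x s] by (meson enat_ord_simps(1) order_trans)
      also have "\<dots> = complexity U s + enat (2 * c)" by (simp add: p(2))
      also have "\<dots> \<le> complexity C s + enat d + enat (2 * c)" by (rule add_right_mono[OF d])
      finally show ?thesis by (simp add: add.assoc)
    qed
    then show "\<exists>d::nat. \<forall>s. complexity V s \<le> complexity C s + enat d" by blast
  qed
  moreover obtain c where
    c: "\<And>m n s. m \<le> n \<Longrightarrow> ?h n s \<le> ?h m s + (n - m) div 2 + c"
    using pair_complexity_le[OF assms] by blast
  have upper: "real (card (programs V n s)) \<le> 2 powr (real n - real (?h n s) + real (c + 3))" for n s
  proof -
    \<comment> \<open>Programs of length \<open>m\<close> that extend a surviving program of length
      \<open>l\<close>; for given \<open>m\<close>, \<open>l\<close> and \<open>s\<close> there is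
      at most one such survivor.\<close>
    let ?X = "\<lambda>m l. {x. length x = m \<and> (\<exists>p. prefix p x \<and> length p = l \<and> S p (b (str_of_nat m, s)))}"
    have card_X: "card (?X m l) \<le> 2 ^ (m - l)" for m l
    proof (cases "\<exists>p. length p = l \<and> S p (b (str_of_nat m, s))")
      case True
      then obtain p where p: "length p = l" "S p (b (str_of_nat m, s))" by blast
      then have "?X m l = {x. prefix p x \<and> length x = m}" using S_unique by blast
      then show ?thesis using p(1) by (simp add: card_extensions)
    next
      case False
      then have "?X m l = {}" by blast
      then show ?thesis by (metis card.empty zero_le)
    qed
    have "programs V n s \<subseteq> (\<Union>m\<le>n. \<Union>l\<in>{?h m s..m}. ?X m l)"
    proof
      fix x assume "x \<in> programs V n s"
      then obtain p where p: "length x \<le> n" "prefix p x" "S p (b (str_of_nat (length x), s))"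
        using V_iff by (auto simp: programs_def)
      then show "x \<in> (\<Union>m\<le>n. \<Union>l\<in>{?h m s..m}. ?X m l)"
        using S_ge[OF p(3)] prefix_length_le[OF p(2)] by auto
    qed
    moreover have "finite (?X m l)" for m l
      by (rule finite_subset[OF _ finite_lists_length_le[of UNIV m]]) auto
    ultimately have "card (programs V n s) \<le> card (\<Union>m\<le>n. \<Union>l\<in>{?h m s..m}. ?X m l)"
      by (intro card_mono) auto
    also have "\<dots> \<le> (\<Sum>m\<le>n. card (\<Union>l\<in>{?h m s..m}. ?X m l))"
      by (rule card_UN_le) simp
    also have "\<dots> \<le> (\<Sum>m\<le>n. \<Sum>l\<in>{?h m s..m}. 2 ^ (m - l))"
      by (intro sum_mono order_trans[OF card_UN_le] card_X) simp
    finally have "real (card (programs V n s)) \<le> real (\<Sum>m\<le>n. \<Sum>l\<in>{?h m s..m}. 2 ^ (m - l))"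
      by (rule of_nat_mono)
    also have "\<dots> = (\<Sum>m\<le>n. \<Sum>l\<in>{?h m s..m}. 2 ^ (m - l))" by simp
    also have "\<dots> \<le> (\<Sum>m\<le>n. 2 powr (real n - real (?h n s) + real (c + 1)) * (3 / 4) ^ (n - m))"
    proof (rule sum_mono)
      fix m assume "m \<in> {..n}"
      then have m: "m \<le> n" by simp
      let ?k = "n - m"
      have "(\<Sum>l\<in>{?h m s..m}. 2 ^ (m - l)) \<le> 2 powr (real m - real (?h m s) + 1)"
        by (rule sum_power2_diff_le)
      \<comment> \<open>The growth bound gives
        \<open>- ?h m s \<le> - ?h n s + ?k div 2 + c\<close>, and
        \<open>m = n - ?k\<close>.\<close>
      also have "\<dots> \<le> 2 powr ((real n - real (?h n s) + real (c + 1)) + real (?k div 2) - real ?k)"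
        using c[OF m, of s] m by (intro powr_mono) (simp_all add: of_nat_diff)
      also have "\<dots> = 2 powr (real n - real (?h n s) + real (c + 1)) * (2 ^ (?k div 2) / 2 ^ ?k)"
        by (simp add: powr_add powr_diff powr_realpow)
      also have "\<dots> \<le> 2 powr (real n - real (?h n s) + real (c + 1)) * ((3 / 2) ^ ?k / 2 ^ ?k)"
        by (intro mult_left_mono divide_right_mono power2_half_le) simp_all
      also have "(3 / 2) ^ ?k / 2 ^ ?k = (3 / 4 :: real) ^ ?k"
        by (simp flip: power_divide)
      finally show "(\<Sum>l\<in>{?h m s..m}. 2 ^ (m - l))
        \<le> 2 powr (real n - real (?h n s) + real (c + 1)) * (3 / 4) ^ ?k" .
    qed
    \<comment> \<open>The geometric series contributes \<open>4 = 2 ^ 2\<close>, which raises the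
      constant from \<open>c + 1\<close> to \<open>c + 3\<close>.\<close>
    also have "\<dots> \<le> 2 powr (real n - real (?h n s) + real (c + 1)) * 4"
      unfolding sum_distrib_left[symmetric]
      by (intro mult_left_mono sum_power_three_quarters) simp
    also have "\<dots> = 2 powr (real n - real (?h n s) + real (c + 3))"
      by (simp add: powr_add)
    finally show ?thesis .
  qed
  moreover have "2 powr (real n - real (?h n s) - real (c + 3)) \<le> real (card (programs V n s))"
    if ge: "real (c + 3) \<le> real n - real (?h n s)" for n s
  proof -
    have le: "?h n s \<le> n" using ge by linarith
    have "2 powr (real n - real (?h n s) - real (c + 3)) \<le> 2 powr real (n - ?h n s)"
      using le by (intro powr_mono) (simp_all add: of_nat_diff)
    also have "\<dots> = real (2 ^ (n - ?h n s))" by (simp add: powr_realpow)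
    also have "\<dots> \<le> real (card (programs V n s))" using lower[OF le] by (rule of_nat_mono)
    finally show ?thesis .
  qed
  ultimately show ?thesis by blast
qed

end
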